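(* Fix $x\in\mathcal{X}$ and write $H(\theta)=H(x,\theta)$. Assume: (i) $\Theta\subset\mathbb{R}^l$ is compact; (ii) for every $n$, $\mathbb{P}^n_\theta$ has a density $p^n_\theta(\cdot)$ (with respect to a $\sigma$-finite measure on $\Xi^n$ not depending on $\theta$) that is jointly measurable in $\theta\in\Theta$ and its argument in $\Xi^n$ (write $p_\theta=p_\theta^1$); (iii) for any neighborhood $V\in\mathcal{B}_\Theta$ of $\theta^c$ there exists a sequence of uniformly consistent tests of the hypothesis $\tilde\theta=\theta^c$ against the alternative $\tilde\theta\in\Theta\setminus V$; (iv) for any $\epsilon>0$ and any neighborhood $V\in\mathcal{B}_\Theta$ of $\theta^c$, $V$ contains a subset $W$ with $\pi(W)>0$ and $D_{KL}(p_{\theta^c}\|p_\theta)<\epsilon$ for all $\theta\in W$; (v) there is a constant $\gamma>0$ such that for all $\epsilon>0$ there exists $M_\epsilon>0$ with $\mathbb{P}^{\mathbb{N}}_{\theta^c}\{\mathbb{E}_{\mathbb{P}_n}[\|\sqrt n(\theta-\theta^c)\|^{1+\gamma}]>M_\epsilon\}<\epsilon$ for all $n$; (vi) (standing assumption) the Bernstein–von Mises property and the asymptotic normality of the posterior mean described in the context hold. If $H$ is continuous on $\Theta$ and differentiable at $\theta^c$, then, under $\mathbb{P}^{\mathbb{N}}_{\theta^c}$, as $n\to\infty$, $$\sqrt n\{\mathbb{E}_{\mathbb{P}_n}[H(\theta)]-H(\theta^c)\}\Rightarrow\mathcal{N}(0,\sigma_x^2),\qquad \sigma_x^2:=\nabla_\theta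 H(x,\theta^c)^\top[I(\theta^c)]^{-1}\nabla_\theta H(x,\theta^c).$$ If furthermore (v) holds with $\gamma=1$, then for any $w\ge0$, as $n\to\infty$, $$\sqrt n\{\mathbb{E}_{\mathbb{P}_n}[H(\theta)]+w\,\mathrm{Var}_{\mathbb{P}_n}[H(\theta)]-H(\theta^c)\}\Rightarrow\mathcal{N}(0,\sigma_x^2).$$
   Context: Setting. $\Theta\subset\mathbb{R}^l$ carries its Borel $\sigma$-algebra $\mathcal{B}_\Theta$ and a prior probability measure $\pi$; $\Xi\subset\mathbb{R}^m$ carries its Borel $\sigma$-algebra and a family of probability measures $\{\mathbb{P}_\theta\}_{\theta\in\Theta}$. $\mathbb{P}^n_\theta$ and $\mathbb{P}^{\mathbb{N}}_\theta$ are the $n$-fold and countably infinite product measures; it is assumed that $\theta\mapsto\mathbb{P}^{\mathbb{N}}_\theta(B)$ is measurable for every measurable $B\subset\Xi^{\mathbb{N}}$. $\theta^c\in\Theta$ is the fixed true parameter; the data $\xi_1,\xi_2,\dots$ are the coordinates on $\Xi^{\mathbb{N}}$ (i.i.d. $\mathbb{P}_{\theta^c}$ under $\mathbb{P}^{\mathbb{N}}_{\theta^c}$). $\tilde\theta$ denotes the Bayesian parameter with prior $\pi$, and $\mathbb{P}_n$ is its posterior given $\xi_1,\dots,\xi_n$: $\mathbb{P}_n(A)=\int_A p^n_\theta(\xi_1,\dots,\xi_n)\pi(d\theta)/\int_\Theta p^n_\theta(\xi_1,\dots,\xi_n)\pi(d\theta)$. $\mathcal{X}\subset\mathbb{R}^d$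 is closed, $h:\mathbb{R}^d\times\mathbb{R}^m\to\mathbb{R}$, and $H(x,\theta):=\mathbb{E}_{\mathbb{P}_\theta}[h(x,\xi)]$ is assumed finite for all $(x,\theta)\in\mathcal{X}\times\Theta$. $\mathbb{E}_{\mathbb{P}_n}$, $\mathrm{Var}_{\mathbb{P}_n}$ are taken with $\theta\sim\mathbb{P}_n$. $\|\cdot\|$ is the Euclidean norm; $\Rightarrow$ is convergence in distribution; $D_{KL}$ is the Kullback–Leibler divergence. Uniformly consistent tests of $\tilde\theta=\theta^c$ against $\tilde\theta\in\Theta\setminus V$: measurable $\varphi_n:\Xi^n\to[0,1]$ with $\mathbb{E}_{\mathbb{P}^n_{\theta^c}}[\varphi_n]\to0$ and $\sup_{\theta\in\Theta\setminus V}\mathbb{E}_{\mathbb{P}^n_\theta}[1-\varphi_n]\to0$. Standing assumption (vi): $I(\theta^c)$, the Fisher information matrix of one observation $\xi_i$ at $\theta^c$, exists and is invertible; with $\mathbb{P}_{Z_n}$ the law of $\sqrt n(\theta-\theta^c)$ for $\theta\sim\mathbb{P}_n$, there are random vectors $\Delta_n$ (functions of $\xi_1,\dots,\xi_n$) with $\Delta_n\Rightarrow\mathcal{N}(0,[I(\theta^c)]^{-1})$ and $\|\mathbb{P}_{Z_n}-\mathcal{N}(\Delta_n,[I(\theta^c)]^{-1})\|_{TV}\to0$ in $\mathbb{P}^{\mathbb{N}}_{\theta^c}$-probability, where $\|\mu-\nu\|_{TV}=\sup_A|\mu(A)-\nu(A)|$; and $\sqrt n(\mathbb{E}_{\mathbb{P}_n}[\theta]-\theta^c)\Rightarrow\mathcal{N}(0,[I(\theta^c)]^{-1})$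 under $\mathbb{P}^{\mathbb{N}}_{\theta^c}$. *)

theory Defs
  imports "HOL-Probability.Probability"
begin

section \<open>Model, data and posterior\<close>

abbreviation borel_on :: "'a::topological_space set \<Rightarrow> 'a measure" where
  "borel_on S \<equiv> restrict_space borel S"

text \<open>
  The \<open>n\<close>-fold and the countably infinite product of \<open>P \<theta>\<close>. Coordinates are numbered from \<open>0\<close>:
  the \<open>i\<close>-th observation \<open>\<xi>\<^sub>i\<close> is \<open>\<omega> (i - 1)\<close>, and \<open>restrict \<omega> {..<n}\<close> is
  \<open>(\<xi>\<^sub>1, \<dots>, \<xi>\<^sub>n)\<close>.
\<close>

abbreviation (input) iid_n :: "('p \<Rightarrow> 'm measure) \<Rightarrow> nat \<Rightarrow> 'p \<Rightarrow> (nat \<Rightarrow> 'm) measure" where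
  "iid_n P n \<theta> \<equiv> \<Pi>\<^sub>M i\<in>{..<n}. P \<theta>"

abbreviation (input) iid_seq :: "('p \<Rightarrow> 'm measure) \<Rightarrow> 'p \<Rightarrow> (nat \<Rightarrow> 'm) measure" where
  "iid_seq P \<theta> \<equiv> \<Pi>\<^sub>M i\<in>(UNIV :: nat set). P \<theta>"

text \<open>
  Bayes' formula. Where the normalizing constant is \<open>0\<close> or infinite (under the hypotheses of the
  theorem a null set of data), the result is the null measure.
\<close>

definition posterior ::
  "'p measure \<Rightarrow> (nat \<Rightarrow> 'p \<Rightarrow> (nat \<Rightarrow> 'm) \<Rightarrow> real) \<Rightarrow> nat \<Rightarrow> (nat \<Rightarrow> 'm) \<Rightarrow> 'p measure"
where
  "posterior prior p n \<omega> =
     density prior (\<lambda>\<theta>. ennreal (p n \<theta> (restrict \<omega> {..<n})) /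
                         (\<integral>\<^sup>+\<tau>. ennreal (p n \<tau> (restrict \<omega> {..<n})) \<partial>prior))"

definition variance_under :: "'a measure \<Rightarrow> ('a \<Rightarrow> real) \<Rightarrow> real" where
  "variance_under M f = (\<integral>a. (f a - (\<integral>b. f b \<partial>M))\<^sup>2 \<partial>M)"

definition expected_cost :: "('p \<Rightarrow> 'm measure) \<Rightarrow> ('d \<Rightarrow> 'm \<Rightarrow> real) \<Rightarrow> 'd \<Rightarrow> 'p \<Rightarrow> real" where
  "expected_cost P h x \<theta> = (\<integral>\<xi>. h x \<xi> \<partial>P \<theta>)"

definition borel_nhd :: "'a::topological_space set \<Rightarrow> 'a \<Rightarrow> 'a set \<Rightarrow> bool" where
  "borel_nhd \<Theta> \<theta>0 V \<longleftrightarrow> V \<in> sets (borel_on \<Theta>) \<and> (\<exists>U. open U \<and> \<theta>0 \<in> U \<and> U \<inter> \<Theta> \<subseteq> V)"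

section \<open>Tests and divergences\<close>

text \<open>The supremum is taken in \<^typ>\<open>ennreal\<close>, so that it is \<open>0\<close> for an empty alternative.\<close>

definition uniformly_consistent_tests ::
  "'m measure \<Rightarrow> ('p \<Rightarrow> 'm measure) \<Rightarrow> 'p \<Rightarrow> 'p set \<Rightarrow> (nat \<Rightarrow> (nat \<Rightarrow> 'm) \<Rightarrow> real) \<Rightarrow> bool"
where
  "uniformly_consistent_tests N P \<theta>0 A \<phi> \<longleftrightarrow>
     (\<forall>n\<ge>1. \<phi> n \<in> borel_measurable (\<Pi>\<^sub>M i\<in>{..<n}. N) \<and>
             (\<forall>y\<in>space (\<Pi>\<^sub>M i\<in>{..<n}. N). 0 \<le> \<phi> n y \<and> \<phi> n y \<le> 1)) \<and>
     (\<lambda>n. \<integral>y. \<phi> n y \<partial>iid_n P n \<theta>0) \<longlonglongrightarrow> 0 \<and>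
     (\<lambda>n. SUP \<theta>\<in>A. \<integral>\<^sup>+y. ennreal (1 - \<phi> n y) \<partial>iid_n P n \<theta>) \<longlonglongrightarrow> 0"

text \<open>
  Divergence of \<open>M\<close> from \<open>N\<close> (natural logarithm). \<^const>\<open>KL_divergence\<close> takes its arguments in the
  opposite order and is a real number even where the divergence is infinite. The negative part of
  the log-likelihood ratio is always integrable, so failure of integrability means \<open>\<infinity>\<close>.
\<close>

definition KL :: "'a measure \<Rightarrow> 'a measure \<Rightarrow> ereal" where
  "KL M N = (if absolutely_continuous N M \<and> integrable M (entropy_density (exp 1) N M)
             then ereal (KL_divergence (exp 1) N M) else \<infinity>)"

definition tv_dist :: "'a::topological_space measure \<Rightarrow> 'a measure \<Rightarrow> real" where
  "tv_dist M N = (SUP A\<in>sets borel. \<bar>measure M A - measure N A\<bar>)"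

section \<open>Fisher information\<close>

text \<open>
  \<open>J\<close> is the matrix of second moments, under \<open>M\<close>, of the score \<open>s = \<nabla>\<^sub>\<theta> ln f \<theta>\<close> at \<open>\<theta>0\<close>, where
  \<open>f \<theta>\<close> are the densities and \<open>M\<close> is the law with density \<open>f \<theta>0\<close>. The gradient is taken within
  \<open>\<Theta>\<close>, where the densities are defined. Positivity is required because \<open>ln 0 = 0\<close> in HOL.
\<close>

definition has_fisher_information ::
  "(real^'l) set \<Rightarrow> real^'l \<Rightarrow> 'y measure \<Rightarrow> (real^'l \<Rightarrow> 'y \<Rightarrow> real) \<Rightarrow> real^'l^'l \<Rightarrow> bool"
where
  "has_fisher_information \<Theta> \<theta>0 M f J \<longleftrightarrow>
     (\<exists>s \<in> borel_measurable M.
        (AE y in M. (\<forall>\<^sub>F \<theta> in at \<theta>0 within \<Theta>. 0 < f \<theta> y) \<and>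
           ((\<lambda>\<theta>. ln (f \<theta> y)) has_derivative (\<lambda>u. s y \<bullet> u)) (at \<theta>0 within \<Theta>)) \<and>
        (\<forall>i j. integrable M (\<lambda>y. s y $ i * s y $ j) \<and>
               J $ i $ j = (\<integral>y. s y $ i * s y $ j \<partial>M)))"

section \<open>Normal laws and convergence in distribution\<close>

text \<open>Meaningful for a positive definite covariance matrix \<open>S\<close>.\<close>

definition mvnormal :: "real^'l \<Rightarrow> real^'l^'l \<Rightarrow> (real^'l) measure" where
  "mvnormal \<mu> S = density lborel (\<lambda>z. ennreal
     (exp (- ((z - \<mu>) \<bullet> (matrix_inv S *v (z - \<mu>))) / 2) / sqrt ((2 * pi) ^ CARD('l) * det S)))"

text \<open>The law with mean \<open>\<mu>\<close> and variance \<open>v \<ge> 0\<close>, a point mass if \<open>v = 0\<close>.\<close>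

definition normal_law :: "real \<Rightarrow> real \<Rightarrow> real measure" where
  "normal_law \<mu> v =
     (if v = 0 then return borel \<mu> else density lborel (\<lambda>z. ennreal (normal_density \<mu> (sqrt v) z)))"

text \<open>The library's \<^const>\<open>weak_conv_m\<close> covers measures on the real line only.\<close>

definition weak_conv_vec :: "(nat \<Rightarrow> 'a::euclidean_space measure) \<Rightarrow> 'a measure \<Rightarrow> bool" where
  "weak_conv_vec Ms M \<longleftrightarrow>
     (\<forall>f :: 'a \<Rightarrow> real. continuous_on UNIV f \<and> bounded (range f) \<longrightarrow>
        (\<lambda>n. \<integral>z. f z \<partial>Ms n) \<longlonglongrightarrow> (\<integral>z. f z \<partial>M))"

section \<open>Posterior moments and the Bernstein--von Mises property\<close>

definition post_moment_tight ::
  "'w measure \<Rightarrow> (nat \<Rightarrow> 'w \<Rightarrow> 'p measure) \<Rightarrow> 'p::real_normed_vector \<Rightarrow> real \<Rightarrow> bool"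
where
  "post_moment_tight D post \<theta>0 \<gamma> \<longleftrightarrow>
     (\<forall>\<epsilon>>0. \<exists>M>0. \<forall>n\<ge>1.
        measure D {\<omega> \<in> space D.
          (\<integral>\<theta>. norm (sqrt (real n) *\<^sub>R (\<theta> - \<theta>0)) powr (1 + \<gamma>) \<partial>post n \<omega>) > M} < \<epsilon>)"

definition bernstein_von_mises ::
  "'m measure \<Rightarrow> (nat \<Rightarrow> 'm) measure \<Rightarrow> (nat \<Rightarrow> (nat \<Rightarrow> 'm) \<Rightarrow> (real^'l) measure) \<Rightarrow>
   real^'l \<Rightarrow> real^'l^'l \<Rightarrow> bool"
where
  "bernstein_von_mises N D post \<theta>0 S \<longleftrightarrow>
     (\<exists>\<Delta> :: nat \<Rightarrow> (nat \<Rightarrow> 'm) \<Rightarrow> real^'l.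
        (\<forall>n\<ge>1. \<Delta> n \<in> borel_measurable (\<Pi>\<^sub>M i\<in>{..<n}. N)) \<and>
        weak_conv_vec (\<lambda>n. distr D borel (\<lambda>\<omega>. \<Delta> n (restrict \<omega> {..<n}))) (mvnormal 0 S) \<and>
        (\<forall>\<epsilon>>0. (\<lambda>n. measure D {\<omega> \<in> space D.
            tv_dist (distr (post n \<omega>) borel (\<lambda>\<theta>. sqrt (real n) *\<^sub>R (\<theta> - \<theta>0)))
                    (mvnormal (\<Delta> n (restrict \<omega> {..<n})) S) > \<epsilon>}) \<longlonglongrightarrow> 0))"

end

theory Submission
  imports Defs
begin

text \<open>
  Write \<open>E\<^sub>n\<close> for the posterior expectation, \<open>g\<close> for the gradient of \<open>H\<close> at \<open>\<theta>c\<close> and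
  \<open>Z\<^sub>n = \<surd>n (E\<^sub>n \<theta> - \<theta>c)\<close>. Compactness, continuity and differentiability give
  \<open>\<bar>H \<theta> - H \<theta>c - g \<bullet> (\<theta> - \<theta>c)\<bar> \<le> \<eta> \<parallel>\<theta> - \<theta>c\<parallel> + K \<parallel>\<theta> - \<theta>c\<parallel>\<^bsup>1+\<gamma>\<^esup>\<close> on \<open>\<Theta>\<close>, with \<open>\<eta>\<close> arbitrarily small.
  Integrating against the posterior, \<open>\<surd>n (E\<^sub>n H - H \<theta>c)\<close> differs from \<open>g \<bullet> Z\<^sub>n\<close> by at most
  \<open>\<eta> (1 + T\<^sub>n) + K n\<^bsup>-\<gamma>/2\<^esup> T\<^sub>n\<close>, where \<open>T\<^sub>n = E\<^sub>n \<parallel>\<surd>n (\<theta> - \<theta>c)\<parallel>\<^bsup>1+\<gamma>\<^esup>\<close> is tight, and for \<open>\<gamma> = 1\<close> the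
  term \<open>\<surd>n Var\<^sub>n H\<close> is \<open>O(n\<^bsup>-1/2\<^esup> T\<^sub>n)\<close>. Slutsky's lemma then reduces the claim to the normality of
  linear functionals of a Gaussian vector. The estimates need the posterior to be a probability
  measure almost surely. This follows from the divergence condition: where it is finite, the true
  law of the data is absolutely continuous with respect to a set of models of positive prior mass.
\<close>

section \<open>Linear functionals of Gaussian vectors\<close>

lemma nn_integral_lborel_shift:
  fixes f :: "'a::euclidean_space \<Rightarrow> ennreal"
  assumes [measurable]: "f \<in> borel_measurable borel"
  shows "(\<integral>\<^sup>+z. f (c + z) \<partial>lborel) = (\<integral>\<^sup>+z. f z \<partial>lborel)"
proof -
  have "(\<integral>\<^sup>+z. f z \<partial>lborel) = (\<integral>\<^sup>+z. f z \<partial>distr lborel borel ((+) c))"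
    by (simp add: lborel_distr_plus)
  also have "\<dots> = (\<integral>\<^sup>+z. f (c + z) \<partial>lborel)"
    by (subst nn_integral_distr) auto
  finally show ?thesis by simp
qed

text \<open>
  The shift identity says that \<open>e\<^bsup>x\<^sup>2/(2v)\<^esup> \<partial>\<rho>\<close> is translation invariant. By Fubini it is then a
  multiple of Lebesgue measure.
\<close>

lemma normal_law_eqI_pos:
  fixes \<rho> :: "real measure" and v :: real
  assumes "v > 0" and \<rho>: "prob_space \<rho>" and sets_\<rho>[measurable_cong]: "sets \<rho> = sets borel"
    and shift: "\<And>a f. f \<in> borel_measurable borel \<Longrightarrow>
      (\<integral>\<^sup>+x. f (x + a * v) \<partial>\<rho>) = (\<integral>\<^sup>+x. f x * ennreal (exp (a * x - a\<^sup>2 * v / 2)) \<partial>\<rho>)"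
  shows "\<rho> = normal_law 0 v"
proof -
  interpret \<rho>: prob_space \<rho> by fact
  interpret L: pair_sigma_finite lborel \<rho> by unfold_locales
  define e where "e x = exp (x\<^sup>2 / (2 * v))" for x
  have [measurable]: "e \<in> borel_measurable borel" unfolding e_def by measurable
  define I where "I F = (\<integral>\<^sup>+x. F x * ennreal (e x) \<partial>\<rho>)" for F :: "real \<Rightarrow> ennreal"
  \<comment> \<open>The weight \<open>e\<close> undoes the tilt in \<open>shift\<close>: for
    \<open>a = s / v\<close> the exponent of \<open>e (x - s)\<close> and that of the tilt add up to
    the exponent of \<open>e x\<close>.\<close>
  have inv: "I (\<lambda>x. F (x + s)) = I F" if [measurable]: "F \<in> borel_measurable borel" for F s
  proof -
    have "I (\<lambda>x. F (x + s)) = (\<integral>\<^sup>+x. (\<lambda>y. F y * ennreal (e (y - s))) (x + (s / v) * v) \<partial>\<rho>)"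
      unfolding I_def using \<open>v > 0\<close> by simp
    also have "\<dots> = (\<integral>\<^sup>+x. F x * ennreal (e (x - s)) *
                     ennreal (exp ((s / v) * x - (s / v)\<^sup>2 * v / 2)) \<partial>\<rho>)"
      by (rule shift) measurable
    also have "\<dots> = I F"
      unfolding I_def
    proof (rule nn_integral_cong)
      fix x
      have "(x - s)\<^sup>2 / (2 * v) + ((s / v) * x - (s / v)\<^sup>2 * v / 2) = x\<^sup>2 / (2 * v)"
        using \<open>v > 0\<close> by (simp add: field_simps power2_eq_square)
      then show "F x * ennreal (e (x - s)) * ennreal (exp ((s / v) * x - (s / v)\<^sup>2 * v / 2))
        = F x * ennreal (e x)"
        by (simp add: e_def mult.assoc flip: ennreal_mult exp_add)
    qed
    finally show ?thesis .
  qed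
  \<comment> \<open>Any nonnegative Borel function of Lebesgue integral 1 would serve as
    \<open>k\<close>. Averaging \<open>I F\<close> over shifts with weight \<open>k\<close> and
    substituting \<open>y = x + s\<close> separates \<open>F\<close> from the rest, which is the
    constant \<open>C\<close> by invariance.\<close>
  define k :: "real \<Rightarrow> ennreal" where "k = indicator {0..1}"
  have [measurable]: "k \<in> borel_measurable borel" unfolding k_def by measurable
  have k1: "(\<integral>\<^sup>+s. k s \<partial>lborel) = 1" unfolding k_def by simp
  define C where "C = I (\<lambda>x. k (- x))"
  have leb: "I F = C * (\<integral>\<^sup>+y. F y \<partial>lborel)" if [measurable]: "F \<in> borel_measurable borel" for F
  proof -
    have "I F = (\<integral>\<^sup>+s. k s * I F \<partial>lborel)"
      by (simp add: nn_integral_multc k1)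
    also have "\<dots> = (\<integral>\<^sup>+s. k s * I (\<lambda>x. F (x + s)) \<partial>lborel)"
      by (simp add: inv)
    also have "\<dots> = (\<integral>\<^sup>+s. (\<integral>\<^sup>+x. k s * (F (x + s) * ennreal (e x)) \<partial>\<rho>) \<partial>lborel)"
      unfolding I_def by (simp add: nn_integral_cmult)
    also have "\<dots> = (\<integral>\<^sup>+x. (\<integral>\<^sup>+s. k s * (F (x + s) * ennreal (e x)) \<partial>lborel) \<partial>\<rho>)"
      by (rule L.Fubini'[symmetric]) measurable
    also have "\<dots> = (\<integral>\<^sup>+x. (\<integral>\<^sup>+y. k (y - x) * (F y * ennreal (e x)) \<partial>lborel) \<partial>\<rho>)"
    proof (rule nn_integral_cong)
      fix x
      show "(\<integral>\<^sup>+s. k s * (F (x + s) * ennreal (e x)) \<partial>lborel) =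
            (\<integral>\<^sup>+y. k (y - x) * (F y * ennreal (e x)) \<partial>lborel)"
        using nn_integral_lborel_shift[of "\<lambda>y. k (y - x) * (F y * ennreal (e x))" x] by simp
    qed
    also have "\<dots> = (\<integral>\<^sup>+y. (\<integral>\<^sup>+x. k (y - x) * (F y * ennreal (e x)) \<partial>\<rho>) \<partial>lborel)"
      by (rule L.Fubini') measurable
    also have "\<dots> = (\<integral>\<^sup>+y. F y * C \<partial>lborel)"
    proof (rule nn_integral_cong)
      fix y
      have "(\<integral>\<^sup>+x. k (y - x) * (F y * ennreal (e x)) \<partial>\<rho>) = F y * I (\<lambda>x. k (- (x + - y)))"
        unfolding I_def by (subst nn_integral_cmult[symmetric]) (auto simp: mult_ac)
      also have "I (\<lambda>x. k (- (x + - y))) = C"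
        unfolding C_def by (rule inv) measurable
      finally show "(\<integral>\<^sup>+x. k (y - x) * (F y * ennreal (e x)) \<partial>\<rho>) = F y * C" .
    qed
    also have "\<dots> = C * (\<integral>\<^sup>+y. F y \<partial>lborel)"
      by (simp add: nn_integral_cmult mult.commute[of _ C])
    finally show ?thesis .
  qed
  define c where "c = C * ennreal (sqrt (2 * pi * v))"
  have em: "emeasure \<rho> A = c * emeasure (normal_law 0 v) A" if [measurable]: "A \<in> sets borel" for A
  proof -
    have e1: "ennreal (exp (- x\<^sup>2 / (2 * v))) * ennreal (e x) = 1" for x
      by (simp add: e_def flip: ennreal_mult exp_add)
    have e2: "ennreal (exp (- x\<^sup>2 / (2 * v)))
        = ennreal (sqrt (2 * pi * v)) * ennreal (normal_density 0 (sqrt v) x)" for x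
      using \<open>v > 0\<close> by (simp add: normal_density_def flip: ennreal_mult)
    have "emeasure \<rho> A = (\<integral>\<^sup>+x. indicator A x \<partial>\<rho>)" by (simp add: sets_\<rho>)
    also have "\<dots> = I (\<lambda>x. indicator A x * ennreal (exp (- x\<^sup>2 / (2 * v))))"
      unfolding I_def by (simp only: mult.assoc e1 mult_1_right)
    also have "\<dots> = C * (\<integral>\<^sup>+x. indicator A x * ennreal (exp (- x\<^sup>2 / (2 * v))) \<partial>lborel)"
      by (rule leb) measurable
    also have "\<dots> = C * (\<integral>\<^sup>+x. ennreal (sqrt (2 * pi * v)) *
        (ennreal (normal_density 0 (sqrt v) x) * indicator A x) \<partial>lborel)"
      unfolding e2 by (simp only: mult_ac)
    also have "\<dots> = c * emeasure (normal_law 0 v) A"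
      using \<open>v > 0\<close>
      by (simp add: nn_integral_cmult c_def normal_law_def emeasure_density mult.assoc)
    finally show ?thesis .
  qed
  \<comment> \<open>Comparing total masses gives \<open>c = 1\<close>, so \<open>C\<close> never has
    to be evaluated.\<close>
  have "prob_space (normal_law 0 v)"
    unfolding normal_law_def using \<open>v > 0\<close> by (auto intro!: prob_space_normal_density)
  then have "c = 1"
    using em[of UNIV] prob_space.emeasure_space_1[of "normal_law 0 v"] \<rho>.emeasure_space_1
      sets_eq_imp_space_eq[OF sets_\<rho>] \<open>v > 0\<close> by (simp add: normal_law_def)
  with em show ?thesis
    by (intro measure_eqI) (use \<open>v > 0\<close> in \<open>simp_all add: sets_\<rho> normal_law_def\<close>)
qed

text \<open>The shift identity is the Cameron-Martin formula on the line, and it determines the law.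
  The degenerate case occurs when the gradient vanishes. For \<open>v = 0\<close> the choice
  \<open>f = 1\<close> says that \<open>exp (a * x)\<close> has mean 1 for every \<open>a\<close>;
  hence the nonnegative function \<open>exp x + exp (- x) - 2\<close> has mean 0, and
  \<open>x = 0\<close> almost surely.\<close>

lemma normal_law_eqI:
  fixes \<rho> :: "real measure" and v :: real
  assumes "v \<ge> 0" and \<rho>: "prob_space \<rho>" and sets_\<rho>[measurable_cong]: "sets \<rho> = sets borel"
    and shift: "\<And>a f. f \<in> borel_measurable borel \<Longrightarrow>
      (\<integral>\<^sup>+x. f (x + a * v) \<partial>\<rho>) = (\<integral>\<^sup>+x. f x * ennreal (exp (a * x - a\<^sup>2 * v / 2)) \<partial>\<rho>)"
  shows "\<rho> = normal_law 0 v"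
proof (cases "v = 0")
  case False
  with assms show ?thesis by (intro normal_law_eqI_pos) auto
next
  case True
  interpret \<rho>: prob_space \<rho> by fact
  have one: "(\<integral>\<^sup>+x. ennreal (exp (a * x)) \<partial>\<rho>) = 1" for a
    using shift[of "\<lambda>_. 1" a] True by (simp add: \<rho>.emeasure_space_1)
  have pos: "0 \<le> exp x + exp (- x) - 2" for x :: real
    using exp_ge_add_one_self[of x] exp_ge_add_one_self[of "- x"] by linarith
  \<comment> \<open>The 2 is carried on the left because subtraction in \<open>ennreal\<close> is
    truncated; being finite, it cancels at the end.\<close>
  have "2 + (\<integral>\<^sup>+x. ennreal (exp x + exp (- x) - 2) \<partial>\<rho>)
      = (\<integral>\<^sup>+x. 2 + ennreal (exp x + exp (- x) - 2) \<partial>\<rho>)"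
    by (simp add: nn_integral_add \<rho>.emeasure_space_1)
  also have "\<dots> = (\<integral>\<^sup>+x. ennreal (exp x) + ennreal (exp (- x)) \<partial>\<rho>)"
  proof (rule nn_integral_cong)
    fix x :: real
    have "ennreal 2 + ennreal (exp x + exp (- x) - 2) = ennreal (exp x + exp (- x))"
      using pos[of x] by (subst ennreal_plus[symmetric]) auto
    then show "2 + ennreal (exp x + exp (- x) - 2) = ennreal (exp x) + ennreal (exp (- x))"
      by simp
  qed
  also have "\<dots> = 2"
    using one[of 1] one[of "-1"] by (simp add: nn_integral_add)
  finally have "(\<integral>\<^sup>+x. ennreal (exp x + exp (- x) - 2) \<partial>\<rho>) = 0"
    using ennreal_add_left_cancel[of 2 _ 0] by simp
  then have "AE x in \<rho>. exp x + exp (- x) - 2 \<le> 0"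
    by (subst (asm) nn_integral_0_iff_AE) (auto simp: ennreal_eq_0_iff)
  then have zero: "AE x in \<rho>. x = 0"
  proof eventually_elim
    case (elim x)
    then have "cosh x = 1" using pos[of x] by (simp add: cosh_def)
    then show ?case by simp
  qed
  show ?thesis
  proof (rule measure_eqI)
    show "sets \<rho> = sets (normal_law 0 v)" by (simp add: normal_law_def True sets_\<rho>)
    fix A assume "A \<in> sets \<rho>"
    then have [measurable]: "A \<in> sets borel" by (simp add: sets_\<rho>)
    have "emeasure \<rho> A = (\<integral>\<^sup>+x. indicator A x \<partial>\<rho>)" by (simp add: sets_\<rho>)
    also have "\<dots> = (\<integral>\<^sup>+x. indicator A 0 \<partial>\<rho>)"
      by (rule nn_integral_cong_AE) (use zero in eventually_elim, simp)
    also have "\<dots> = emeasure (normal_law 0 v) A"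
      by (simp add: \<rho>.emeasure_space_1 normal_law_def True)
    finally show "emeasure \<rho> A = emeasure (normal_law 0 v) A" .
  qed
qed

text \<open>Translation by \<open>a\<close> times \<open>w = matrix_inv J *v g\<close> moves
  \<open>g \<bullet> z\<close> by \<open>a * v\<close> and, since \<open>J *v w = g\<close>,
  multiplies the Gaussian density by \<open>exp (a * (g \<bullet> z) - a\<^sup>2 * v / 2)\<close>.
  So the law of \<open>g \<bullet> z\<close> satisfies the shift identity, without diagonalization
  or a Gaussian integral.\<close>

lemma distr_inner_mvnormal:
  fixes J :: "real^'l^'l" and g :: "real^'l"
  assumes "invertible J" and sym: "transpose J = J"
    and psd: "\<And>u. 0 \<le> u \<bullet> (J *v u)"
    and prob: "prob_space (mvnormal 0 (matrix_inv J))"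
  shows "distr (mvnormal 0 (matrix_inv J)) borel ((\<bullet>) g) = normal_law 0 (g \<bullet> (matrix_inv J *v g))"
proof -
  define S where "S = matrix_inv J"
  define w where "w = S *v g"
  define v where "v = g \<bullet> w"
  have JS: "J ** S = mat 1" and SJ: "S ** J = mat 1"
    using someI_ex[OF \<open>invertible J\<close>[unfolded invertible_def]]
    unfolding S_def matrix_inv_def by auto
  \<comment> \<open>\<open>matrix_inv\<close> is a choice among two-sided inverses: exhibiting
    \<open>J\<close> as one yields \<open>S ** matrix_inv S = mat 1\<close>, and multiplying by
    \<open>J\<close> on the left identifies the chosen matrix.\<close>
  have invS: "matrix_inv S = J"
  proof -
    have "S ** matrix_inv S = mat 1"
      unfolding matrix_inv_def[of S] by (rule someI2[where a = J]) (simp_all add: JS SJ)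
    then show ?thesis
      by (metis JS matrix_mul_assoc matrix_mul_lid matrix_mul_rid)
  qed
  have Jw: "J *v w = g"
    unfolding w_def by (simp add: matrix_vector_mul_assoc JS)
  have "v = w \<bullet> (J *v w)" by (simp add: Jw v_def inner_commute)
  then have "v \<ge> 0" using psd by simp
  have selfadj: "a \<bullet> (J *v b) = (J *v a) \<bullet> b" for a b
    by (metis dot_lmul_matrix sym transpose_matrix_vector)
  define d where "d = (\<lambda>z. ennreal (exp (- (z \<bullet> (J *v z)) / 2) / sqrt ((2 * pi) ^ CARD('l) * det S)))"
  have mv: "mvnormal 0 S = density lborel d"
    unfolding mvnormal_def d_def by (simp add: invS)
  have [measurable]: "(\<lambda>z. J *v z) \<in> borel_measurable borel"
    by (intro borel_measurable_continuous_onI continuous_intros linear_continuous_on)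
      (auto simp: matrix_vector_mul_bounded_linear)
  have [measurable]: "d \<in> borel_measurable borel" unfolding d_def by measurable
  have dshift: "d (z - a *\<^sub>R w) = d z * ennreal (exp (a * (g \<bullet> z) - a\<^sup>2 * v / 2))" for a z
  proof -
    have "(z - a *\<^sub>R w) \<bullet> (J *v (z - a *\<^sub>R w)) = z \<bullet> (J *v z) - 2 * a * (g \<bullet> z) + a\<^sup>2 * v"
      by (simp add: matrix_vector_mult_diff_distrib matrix_vector_mult_scaleR Jw inner_diff_left
          inner_diff_right selfadj[of w z] v_def inner_commute power2_eq_square algebra_simps)
    then have "- ((z - a *\<^sub>R w) \<bullet> (J *v (z - a *\<^sub>R w))) / 2
      = - (z \<bullet> (J *v z)) / 2 + (a * (g \<bullet> z) - a\<^sup>2 * v / 2)"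
      by (simp add: field_simps)
    then have "exp (- ((z - a *\<^sub>R w) \<bullet> (J *v (z - a *\<^sub>R w))) / 2)
      = exp (- (z \<bullet> (J *v z)) / 2) * exp (a * (g \<bullet> z) - a\<^sup>2 * v / 2)"
      by (simp only: exp_add)
    then show ?thesis
      unfolding d_def by (simp add: ennreal_mult''[symmetric])
  qed
  have "distr (mvnormal 0 S) borel ((\<bullet>) g) = normal_law 0 v"
  proof (rule normal_law_eqI[OF \<open>v \<ge> 0\<close>])
    show "prob_space (distr (mvnormal 0 S) borel ((\<bullet>) g))"
      using prob by (intro prob_space.prob_space_distr) (auto simp: S_def mvnormal_def)
    fix a and f :: "real \<Rightarrow> ennreal"
    assume [measurable]: "f \<in> borel_measurable borel"
    have "(\<integral>\<^sup>+x. f (x + a * v) \<partial>distr (mvnormal 0 S) borel ((\<bullet>) g))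
        = (\<integral>\<^sup>+z. d z * f (g \<bullet> z + a * v) \<partial>lborel)"
      unfolding mv by (simp add: nn_integral_distr nn_integral_density)
    \<comment> \<open>Translation invariance of Lebesgue measure moves the shift from the argument
      of \<open>f\<close> to the density, because
      \<open>g \<bullet> (a *\<^sub>R w) = a * v\<close>.\<close>
    also have "\<dots> = (\<integral>\<^sup>+z. d (z - a *\<^sub>R w) * f (g \<bullet> z) \<partial>lborel)"
      using nn_integral_lborel_shift[of "\<lambda>z. d (z - a *\<^sub>R w) * f (g \<bullet> z)" "a *\<^sub>R w"]
      by (simp add: inner_add_right v_def add.commute)
    also have "\<dots> = (\<integral>\<^sup>+z. d z * (f (g \<bullet> z) * ennreal (exp (a * (g \<bullet> z) - a\<^sup>2 * v / 2))) \<partial>lborel)"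
      by (simp add: dshift mult_ac)
    also have "\<dots> = (\<integral>\<^sup>+x. f x * ennreal (exp (a * x - a\<^sup>2 * v / 2))
        \<partial>distr (mvnormal 0 S) borel ((\<bullet>) g))"
      unfolding mv by (simp add: nn_integral_distr nn_integral_density)
    finally show "(\<integral>\<^sup>+x. f (x + a * v) \<partial>distr (mvnormal 0 S) borel ((\<bullet>) g)) = \<dots>" .
  qed simp
  then show ?thesis by (simp add: S_def v_def w_def)
qed

lemma has_fisher_information_transpose:
  assumes "has_fisher_information \<Theta> \<theta>0 M f J"
  shows "transpose J = J"
  using assms unfolding has_fisher_information_def
  by (auto simp: transpose_def vec_eq_iff mult.commute)

text \<open>The quadratic form of \<open>J\<close> at \<open>u\<close> is the second moment of the
  directional score \<open>u \<bullet> s y\<close>.\<close>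

lemma has_fisher_information_nonneg:
  fixes J :: "real^'l^'l"
  assumes "has_fisher_information \<Theta> \<theta>0 M f J"
  shows "0 \<le> u \<bullet> (J *v u)"
proof -
  obtain s where s: "\<And>i j. integrable M (\<lambda>y. s y $ i * s y $ j)"
    "\<And>i j. J $ i $ j = (\<integral>y. s y $ i * s y $ j \<partial>M)"
    using assms unfolding has_fisher_information_def by blast
  have "u \<bullet> (J *v u) = (\<Sum>i\<in>UNIV. \<Sum>j\<in>UNIV. u $ i * u $ j * (\<integral>y. s y $ i * s y $ j \<partial>M))"
    by (simp add: inner_vec_def matrix_vector_mult_def s(2) sum_distrib_left mult_ac)
  also have "\<dots> = (\<integral>y. (\<Sum>i\<in>UNIV. \<Sum>j\<in>UNIV. u $ i * u $ j * (s y $ i * s y $ j)) \<partial>M)"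
    by (simp add: s(1) Bochner_Integration.integral_sum)
  also have "\<dots> = (\<integral>y. (u \<bullet> s y)\<^sup>2 \<partial>M)"
    by (intro Bochner_Integration.integral_cong)
      (simp_all add: inner_vec_def power2_eq_square sum_product mult_ac)
  finally show ?thesis by simp
qed

section \<open>The posterior\<close>

text \<open>Real-valued weights are what Bochner integration against a density requires. An infinite
  weight could only come from \<open>Z = 0\<close>; then the density vanishes almost everywhere and
  the weight is \<open>0 / 0\<close>, which is 0 in \<open>ennreal\<close>.\<close>

lemma posterior_weight_AE:
  assumes [measurable]: "(\<lambda>\<theta>. p n \<theta> (restrict \<omega> {..<n})) \<in> borel_measurable prior"
  defines "Z \<equiv> (\<integral>\<^sup>+\<tau>. ennreal (p n \<tau> (restrict \<omega> {..<n})) \<partial>prior)"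
  shows "AE \<theta> in prior. ennreal (p n \<theta> (restrict \<omega> {..<n})) / Z
     = ennreal (enn2real (ennreal (p n \<theta> (restrict \<omega> {..<n})) / Z))"
proof (cases "Z = 0")
  case True
  then have "AE \<theta> in prior. ennreal (p n \<theta> (restrict \<omega> {..<n})) = 0"
    unfolding Z_def by (subst (asm) nn_integral_0_iff_AE) auto
  then show ?thesis by eventually_elim simp
next
  case False
  show ?thesis
  proof (rule AE_I2)
    fix \<theta>
    have "ennreal (p n \<theta> (restrict \<omega> {..<n})) / Z < \<top>"
      using False by (simp add: less_top[symmetric] ennreal_divide_eq_top_iff)
    then show "ennreal (p n \<theta> (restrict \<omega> {..<n})) / Z
     = ennreal (enn2real (ennreal (p n \<theta> (restrict \<omega> {..<n})) / Z))" by simp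
  qed
qed

text \<open>The measure varies with the data, so the integral is rewritten against the fixed prior,
  with a weight that is jointly measurable in data and parameter. This covers every data point, also
  those where the posterior is the null measure. \<open>G\<close> may depend on the data because the
  integrand of the variance contains the posterior mean.\<close>

lemma posterior_integral_measurable:
  fixes G :: "'p \<Rightarrow> (nat \<Rightarrow> 'm) \<Rightarrow> 'b::{banach, second_countable_topology}"
  assumes \<pi>: "prob_space prior"
    and p: "(\<lambda>(\<theta>, y). p n \<theta> y) \<in> borel_measurable (prior \<Otimes>\<^sub>M (\<Pi>\<^sub>M i\<in>{..<n}. N))"
    and G: "(\<lambda>(\<omega>, \<theta>). G \<theta> \<omega>) \<in> borel_measurable ((\<Pi>\<^sub>M i\<in>UNIV. N) \<Otimes>\<^sub>M prior)"
  shows "(\<lambda>\<omega>. \<integral>\<theta>. G \<theta> \<omega> \<partial>posterior prior p n \<omega>) \<in> borel_measurable (\<Pi>\<^sub>M i\<in>UNIV. N)"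
proof -
  interpret prob_space prior by fact
  note G[measurable]
  have r: "(\<lambda>z. restrict (fst z) {..<n}) \<in> measurable ((\<Pi>\<^sub>M i\<in>(UNIV :: nat set). N) \<Otimes>\<^sub>M prior) (\<Pi>\<^sub>M i\<in>{..<n}. N)"
    by (rule measurable_compose[OF measurable_fst measurable_restrict_subset]) simp
  have p'[measurable]: "(\<lambda>z. p n (snd z) (restrict (fst z) {..<n}))
      \<in> borel_measurable ((\<Pi>\<^sub>M i\<in>(UNIV :: nat set). N) \<Otimes>\<^sub>M prior)"
    using measurable_compose[OF measurable_Pair[OF measurable_snd r] p] by simp
  define Z where "Z \<omega> = (\<integral>\<^sup>+\<tau>. ennreal (p n \<tau> (restrict \<omega> {..<n})) \<partial>prior)" for \<omega>
  have [measurable]: "Z \<in> borel_measurable (\<Pi>\<^sub>M i\<in>UNIV. N)"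
    unfolding Z_def
    by (rule borel_measurable_nn_integral) (use p' in \<open>simp add: case_prod_beta'\<close>)
  define q where "q \<omega> \<theta> = ennreal (p n \<theta> (restrict \<omega> {..<n})) / Z \<omega>" for \<omega> \<theta>
  have [measurable]: "(\<lambda>(\<omega>, \<theta>). q \<omega> \<theta>) \<in> borel_measurable ((\<Pi>\<^sub>M i\<in>UNIV. N) \<Otimes>\<^sub>M prior)"
    unfolding q_def case_prod_beta' by measurable
  have "(\<lambda>\<omega>. \<integral>\<theta>. enn2real (q \<omega> \<theta>) *\<^sub>R G \<theta> \<omega> \<partial>prior) \<in> borel_measurable (\<Pi>\<^sub>M i\<in>UNIV. N)"
    by measurable
  moreover have "(\<integral>\<theta>. G \<theta> \<omega> \<partial>posterior prior p n \<omega>) = (\<integral>\<theta>. enn2real (q \<omega> \<theta>) *\<^sub>R G \<theta> \<omega> \<partial>prior)"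
    if \<omega>: "\<omega> \<in> space (\<Pi>\<^sub>M i\<in>UNIV. N)" for \<omega>
  proof -
    have [measurable]: "(\<lambda>\<theta>. G \<theta> \<omega>) \<in> borel_measurable prior"
      "q \<omega> \<in> borel_measurable prior"
      using measurable_Pair2[OF G \<omega>] measurable_Pair2[OF _ \<omega>, of "\<lambda>(\<omega>, \<theta>). q \<omega> \<theta>"]
      by simp_all
    have [measurable]: "(\<lambda>\<theta>. p n \<theta> (restrict \<omega> {..<n})) \<in> borel_measurable prior"
      using measurable_Pair2[OF p' \<omega>] unfolding fst_conv snd_conv .
    have "AE \<theta> in prior. q \<omega> \<theta> = ennreal (enn2real (q \<omega> \<theta>))"
      unfolding q_def Z_def by (rule posterior_weight_AE) measurable
    then have "posterior prior p n \<omega> = density prior (\<lambda>\<theta>. ennreal (enn2real (q \<omega> \<theta>)))"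
      unfolding posterior_def q_def[symmetric] Z_def[symmetric]
      by (intro density_cong) auto
    then show ?thesis by (simp add: integral_density)
  qed
  ultimately show ?thesis by (simp cong: measurable_cong)
qed

text \<open>By Fubini the factors can be exchanged one at a time. Finiteness is essential: infinite
  products of equivalent measures can be mutually singular.\<close>

lemma absolutely_continuous_PiM_finite:
  assumes I: "finite I"
    and M: "\<And>i. prob_space (M i)" and N: "\<And>i. prob_space (N i)"
    and sets_eq: "\<And>i. sets (M i) = sets (N i)"
    and ac: "\<And>i. i \<in> I \<Longrightarrow> absolutely_continuous (M i) (N i)"
  shows "absolutely_continuous (PiM I M) (PiM I N)"
proof -
  interpret M: product_prob_space M
    by (intro product_prob_spaceI M)
  interpret N: product_prob_space N
    by (intro product_prob_spaceI N)
  have eq[measurable_cong]: "sets (PiM J M) = sets (PiM J N)" for J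
    by (rule sets_PiM_cong) (simp_all add: sets_eq)
  note sets_eq[measurable_cong]
  \<comment> \<open>Nonnegative functions replace sets here, since integrating out one coordinate of
    an indicator already gives a general function, to which the induction hypothesis must
    apply.\<close>
  have *: "(\<integral>\<^sup>+x. f x \<partial>PiM I N) = 0"
    if "f \<in> borel_measurable (PiM I M)" "(\<integral>\<^sup>+x. f x \<partial>PiM I M) = 0" for f :: "_ \<Rightarrow> ennreal"
    using I ac that
  proof (induction I arbitrary: f)
    case empty
    then show ?case by (simp add: PiM_empty)
  next
    case (insert i I)
    note [measurable] = insert.prems(2)
    have [measurable]: "(\<lambda>(x, y). f (x(i := y))) \<in> borel_measurable (PiM I M \<Otimes>\<^sub>M M i)"
      by measurable
    have [measurable]: "(\<lambda>x. \<integral>\<^sup>+y. f (x(i := y)) \<partial>M i) \<in> borel_measurable (PiM I M)"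
      by measurable
    have "(\<integral>\<^sup>+x. \<integral>\<^sup>+y. f (x(i := y)) \<partial>M i \<partial>PiM I M) = 0"
      using insert.prems(3) insert.hyps by (simp add: M.product_nn_integral_insert)
    then have "(\<integral>\<^sup>+x. \<integral>\<^sup>+y. f (x(i := y)) \<partial>M i \<partial>PiM I N) = 0"
      using insert.IH insert.prems(1) by simp
    then have "AE x in PiM I N. (\<integral>\<^sup>+y. f (x(i := y)) \<partial>M i) = 0"
      by (subst (asm) nn_integral_0_iff_AE) auto
    then have "AE x in PiM I N. (\<integral>\<^sup>+y. f (x(i := y)) \<partial>N i) = 0"
    proof (rule AE_mp, intro AE_I2 impI)
      fix x assume x: "x \<in> space (PiM I N)" and 0: "(\<integral>\<^sup>+y. f (x(i := y)) \<partial>M i) = 0"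
      have "x \<in> space (PiM I M)" using x sets_eq_imp_space_eq[OF eq] by simp
      then have [measurable]: "(\<lambda>y. f (x(i := y))) \<in> borel_measurable (M i)"
        using measurable_Pair2[of "\<lambda>(x, y). f (x(i := y))" "PiM I M" "M i" borel x] by simp
      have "AE y in M i. f (x(i := y)) = 0"
        using 0 by (subst (asm) nn_integral_0_iff_AE) auto
      then have "AE y in N i. f (x(i := y)) = 0"
        using absolutely_continuous_AE[OF sets_eq[symmetric] insert.prems(1)] by simp
      then show "(\<integral>\<^sup>+y. f (x(i := y)) \<partial>N i) = 0"
        by (subst nn_integral_0_iff_AE) auto
    qed
    then have "(\<integral>\<^sup>+x. \<integral>\<^sup>+y. f (x(i := y)) \<partial>N i \<partial>PiM I N) = 0"
      by (subst nn_integral_0_iff_AE) auto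
    then show ?case
      using insert.hyps by (simp add: N.product_nn_integral_insert)
  qed
  show ?thesis
    unfolding absolutely_continuous_def
  proof
    fix A assume "A \<in> null_sets (PiM I M)"
    then show "A \<in> null_sets (PiM I N)"
      using *[of "indicator A"] by (auto simp: null_sets_def eq)
  qed
qed


text \<open>Finiteness: by Tonelli the evidence \<open>Z\<close> integrates to 1 over
  \<open>\<nu>\<close>. Positivity: the set where \<open>Z\<close> vanishes is null for almost every
  model, hence for some model with parameter in \<open>W\<close>, and absolute continuity carries
  this over to the model at \<open>c\<close>.\<close>

lemma evidence_pos_finite_AE:
  fixes f :: "'p \<Rightarrow> 'y \<Rightarrow> real"
  assumes \<pi>: "prob_space prior" and \<nu>: "sigma_finite_measure \<nu>"
    and f: "(\<lambda>(\<theta>, y). f \<theta> y) \<in> borel_measurable (prior \<Otimes>\<^sub>M \<nu>)"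
    and D: "\<And>\<theta>. \<theta> \<in> space prior \<Longrightarrow> prob_space (density \<nu> (\<lambda>y. ennreal (f \<theta> y)))"
    and c: "c \<in> space prior"
    and W: "W \<in> sets prior" "measure prior W > 0"
    and ac: "\<And>\<theta>. \<theta> \<in> W \<Longrightarrow> absolutely_continuous
      (density \<nu> (\<lambda>y. ennreal (f \<theta> y))) (density \<nu> (\<lambda>y. ennreal (f c y)))"
  defines "Z \<equiv> \<lambda>y. \<integral>\<^sup>+\<theta>. ennreal (f \<theta> y) \<partial>prior"
  shows "AE y in density \<nu> (\<lambda>y. ennreal (f c y)). Z y \<noteq> 0 \<and> Z y \<noteq> \<infinity>"
proof -
  interpret \<pi>: prob_space prior by fact
  interpret \<nu>: sigma_finite_measure \<nu> by fact
  interpret L: pair_sigma_finite \<nu> prior by unfold_locales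
  note f[measurable]
  have f'[measurable]: "f \<theta> \<in> borel_measurable \<nu>" if "\<theta> \<in> space prior" for \<theta>
    using measurable_Pair2[OF f that] by simp
  have [measurable]: "(\<lambda>(y, \<theta>). f \<theta> y) \<in> borel_measurable (\<nu> \<Otimes>\<^sub>M prior)"
    using measurable_pair_swap[OF f] by (simp add: case_prod_beta')
  have [measurable]: "Z \<in> borel_measurable \<nu>" unfolding Z_def by measurable
  define E where "E y = (if Z y = 0 then 1 else 0 :: ennreal)" for y
  have [measurable]: "E \<in> borel_measurable \<nu>" unfolding E_def by measurable
  have "(\<integral>\<^sup>+y. Z y \<partial>\<nu>) = (\<integral>\<^sup>+\<theta>. \<integral>\<^sup>+y. ennreal (f \<theta> y) \<partial>\<nu> \<partial>prior)"
    unfolding Z_def by (rule L.Fubini'[symmetric]) measurable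
  also have "\<dots> = (\<integral>\<^sup>+\<theta>. 1 \<partial>prior)"
  proof (rule nn_integral_cong)
    fix \<theta> assume "\<theta> \<in> space prior"
    then show "(\<integral>\<^sup>+y. ennreal (f \<theta> y) \<partial>\<nu>) = 1"
      using prob_space.emeasure_space_1[OF D, of \<theta>] f'[of \<theta>]
      by (simp add: emeasure_density cong: nn_integral_cong)
  qed
  finally have "(\<integral>\<^sup>+y. Z y \<partial>\<nu>) \<noteq> \<infinity>" by (simp add: \<pi>.emeasure_space_1)
  then have fin: "AE y in \<nu>. Z y \<noteq> \<infinity>" by (intro nn_integral_PInf_AE) auto
  \<comment> \<open>\<open>E\<close> is the indicator of the event \<open>Z = 0\<close>, so the
    inner integral on the left is the probability of that event under the model
    \<open>\<theta>\<close>.\<close>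
  have "(\<integral>\<^sup>+\<theta>. \<integral>\<^sup>+y. ennreal (f \<theta> y) * E y \<partial>\<nu> \<partial>prior)
      = (\<integral>\<^sup>+y. \<integral>\<^sup>+\<theta>. ennreal (f \<theta> y) * E y \<partial>prior \<partial>\<nu>)"
    by (rule L.Fubini') measurable
  also have "\<dots> = (\<integral>\<^sup>+y. Z y * E y \<partial>\<nu>)"
    unfolding Z_def by (intro nn_integral_cong nn_integral_multc) simp
  also have "\<dots> = 0" by (simp add: E_def nn_integral_0_iff_AE)
  finally have "AE \<theta> in prior. (\<integral>\<^sup>+y. ennreal (f \<theta> y) * E y \<partial>\<nu>) = 0"
    by (subst (asm) nn_integral_0_iff_AE) auto
  \<comment> \<open>An almost sure statement about the prior must hold somewhere in
    \<open>W\<close>, as \<open>W\<close> has positive mass.\<close>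
  moreover have "\<not> (AE \<theta> in prior. \<theta> \<notin> W)"
  proof -
    have "{\<theta> \<in> space prior. \<not> \<theta> \<notin> W} = W" using sets.sets_into_space[OF W(1)] by auto
    then show ?thesis using W by (auto simp: AE_iff_measurable[OF W(1)] measure_def)
  qed
  ultimately have "\<exists>\<theta>\<in>W. (\<integral>\<^sup>+y. ennreal (f \<theta> y) * E y \<partial>\<nu>) = 0"
    by (metis (mono_tags, lifting) AE_mp AE_I2)
  then obtain \<theta> where \<theta>: "\<theta> \<in> W" "(\<integral>\<^sup>+y. ennreal (f \<theta> y) * E y \<partial>\<nu>) = 0" by blast
  have \<theta>': "\<theta> \<in> space prior" using \<theta> sets.sets_into_space[OF W(1)] by blast
  note [measurable] = f'[OF \<theta>'] f'[OF c]
  have "AE y in \<nu>. ennreal (f \<theta> y) * E y = 0"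
    using \<theta>(2) by (subst (asm) nn_integral_0_iff_AE) auto
  then have "AE y in density \<nu> (\<lambda>y. ennreal (f \<theta> y)). Z y \<noteq> 0"
    by (subst AE_density, simp, eventually_elim) (auto simp: E_def)
  then have "AE y in density \<nu> (\<lambda>y. ennreal (f c y)). Z y \<noteq> 0"
    using absolutely_continuous_AE[OF _ ac[OF \<theta>(1)]] by simp
  moreover have "AE y in density \<nu> (\<lambda>y. ennreal (f c y)). Z y \<noteq> \<infinity>"
    using fin by (subst AE_density) auto
  ultimately show ?thesis by eventually_elim simp
qed

lemma prob_space_posterior:
  assumes "(\<lambda>\<theta>. p n \<theta> (restrict \<omega> {..<n})) \<in> borel_measurable prior"
    and "(\<integral>\<^sup>+\<tau>. ennreal (p n \<tau> (restrict \<omega> {..<n})) \<partial>prior) \<noteq> 0"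
    and "(\<integral>\<^sup>+\<tau>. ennreal (p n \<tau> (restrict \<omega> {..<n})) \<partial>prior) \<noteq> \<infinity>"
  shows "prob_space (posterior prior p n \<omega>)"
proof
  show "emeasure (posterior prior p n \<omega>) (space (posterior prior p n \<omega>)) = 1"
    unfolding posterior_def using assms
    by (simp add: emeasure_density nn_integral_divide ennreal_divide_self less_top cong: nn_integral_cong)
qed

section \<open>Convergence in distribution\<close>

text \<open>The constant test function 1 fixes the total mass of the limit. An infinite mass is
  excluded because \<open>measure\<close> would then return 0.\<close>

lemma weak_conv_vec_prob_space:
  assumes "weak_conv_vec Ms M" and "\<And>n. prob_space (Ms n)"
  shows "prob_space M"
proof
  have "(\<lambda>n. \<integral>z. (1::real) \<partial>Ms n) \<longlonglongrightarrow> (\<integral>z. 1 \<partial>M)"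
    using assms(1)[unfolded weak_conv_vec_def, rule_format, of "\<lambda>_. 1"] by simp
  then have "measure M (space M) = 1"
    using assms(2) by (simp add: prob_space.prob_space LIMSEQ_const_iff)
  moreover from this have "emeasure M (space M) \<noteq> \<infinity>" by (auto simp: measure_def)
  ultimately show "emeasure M (space M) = 1" by (simp add: emeasure_eq_ennreal_measure)
qed

text \<open>The cosine and sine of \<open>t * (g \<bullet> z)\<close> are bounded and continuous, so
  the characteristic functions of the projections converge, and Levy's continuity theorem
  applies.\<close>

lemma weak_conv_vec_inner:
  fixes Ms :: "nat \<Rightarrow> 'a::euclidean_space measure"
  assumes conv: "weak_conv_vec Ms M"
    and Ms: "\<And>n. prob_space (Ms n)" and sets_Ms: "\<And>n. sets (Ms n) = sets borel"
    and sets_M: "sets M = sets borel"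
  shows "weak_conv_m (\<lambda>n. distr (Ms n) borel ((\<bullet>) g)) (distr M borel ((\<bullet>) g))"
proof (rule levy_continuity)
  interpret M: prob_space M using weak_conv_vec_prob_space[OF conv Ms] .
  interpret Ms: prob_space "Ms n" for n by (rule Ms)
  note [measurable_cong] = sets_Ms sets_M
  show "real_distribution (distr (Ms n) borel ((\<bullet>) g))" for n
    by (intro Ms.real_distribution_distr) measurable
  show "real_distribution (distr M borel ((\<bullet>) g))"
    by (intro M.real_distribution_distr) measurable
  fix t
  have ch: "char (distr M' borel ((\<bullet>) g)) t
      = Complex (\<integral>z. cos (t * (g \<bullet> z)) \<partial>M') (\<integral>z. sin (t * (g \<bullet> z)) \<partial>M')"
    if "prob_space M'" and [measurable_cong]: "sets M' = sets borel" for M' :: "'a measure"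
  proof -
    interpret M': prob_space M' by fact
    have "integrable M' (\<lambda>z. iexp (t * (g \<bullet> z)))"
      by (intro M'.integrable_const_bound[where B = 1]) auto
    then show ?thesis
      unfolding char_def
      by (subst integral_distr) (auto simp: complex_eq_iff Re_exp Im_exp
          simp flip: integral_Re integral_Im)
  qed
  have "continuous_on UNIV (\<lambda>z. cos (t * (g \<bullet> z)))" "continuous_on UNIV (\<lambda>z. sin (t * (g \<bullet> z)))"
    by (intro continuous_intros)+
  moreover have "bounded (range (\<lambda>z. cos (t * (g \<bullet> z))))" "bounded (range (\<lambda>z. sin (t * (g \<bullet> z))))"
    by (auto intro!: boundedI[where B = 1])
  ultimately have
    "(\<lambda>n. \<integral>z. cos (t * (g \<bullet> z)) \<partial>Ms n) \<longlonglongrightarrow> (\<integral>z. cos (t * (g \<bullet> z)) \<partial>M)"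
    "(\<lambda>n. \<integral>z. sin (t * (g \<bullet> z)) \<partial>Ms n) \<longlonglongrightarrow> (\<integral>z. sin (t * (g \<bullet> z)) \<partial>M)"
    using conv unfolding weak_conv_vec_def by blast+
  then show "(\<lambda>n. char (distr (Ms n) borel ((\<bullet>) g)) t) \<longlonglongrightarrow> char (distr M borel ((\<bullet>) g)) t"
    by (simp add: ch Ms M.prob_space_axioms sets_Ms sets_M tendsto_Complex)
qed

text \<open>Slutsky's lemma through characteristic functions: adding \<open>R\<close> multiplies the
  integrand by \<open>iexp (t * R n \<omega>)\<close>, which differs from 1 by at most
  \<open>\<bar>t\<bar> * \<delta>\<close> where
  \<open>\<bar>R n \<omega>\<bar> \<le> \<delta>\<close> and by at most 2 elsewhere.\<close>

lemma (in prob_space) weak_conv_add_null: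
  fixes U R :: "nat \<Rightarrow> 'a \<Rightarrow> real"
  assumes U[measurable]: "\<And>n. U n \<in> borel_measurable M" and R[measurable]: "\<And>n. R n \<in> borel_measurable M"
    and D: "real_distribution D"
    and conv: "weak_conv_m (\<lambda>n. distr M borel (U n)) D"
    and null: "\<And>\<delta>. \<delta> > 0 \<Longrightarrow> (\<lambda>n. prob {\<omega> \<in> space M. \<bar>R n \<omega>\<bar> > \<delta>}) \<longlonglongrightarrow> 0"
  shows "weak_conv_m (\<lambda>n. distr M borel (\<lambda>\<omega>. U n \<omega> + R n \<omega>)) D"
proof (rule levy_continuity)
  show "real_distribution (distr M borel (\<lambda>\<omega>. U n \<omega> + R n \<omega>))" for n
    by (intro real_distribution_distr) measurable
  show "real_distribution D" by fact
  fix t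
  have charU: "(\<lambda>n. char (distr M borel (U n)) t) \<longlonglongrightarrow> char D t"
    by (intro levy_continuity1 real_distribution_distr D conv) measurable
  have bnd: "norm (char (distr M borel (\<lambda>\<omega>. U n \<omega> + R n \<omega>)) t - char (distr M borel (U n)) t)
      \<le> \<bar>t\<bar> * \<delta> + 2 * prob {\<omega> \<in> space M. \<bar>R n \<omega>\<bar> > \<delta>}" if "\<delta> > 0" for n \<delta>
  proof -
    have i1: "integrable M (\<lambda>\<omega>. iexp (t * (U n \<omega> + R n \<omega>)))" and i2: "integrable M (\<lambda>\<omega>. iexp (t * U n \<omega>))"
      by (intro integrable_const_bound[where B = 1]; simp)+
    let ?A = "{\<omega> \<in> space M. \<bar>R n \<omega>\<bar> > \<delta>}"
    have "norm (char (distr M borel (\<lambda>\<omega>. U n \<omega> + R n \<omega>)) t - char (distr M borel (U n)) t)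
      = norm (\<integral>\<omega>. iexp (t * (U n \<omega> + R n \<omega>)) - iexp (t * U n \<omega>) \<partial>M)"
      unfolding char_def using i1 i2 by (simp add: integral_distr)
    also have "\<dots> \<le> (\<integral>\<omega>. norm (iexp (t * (U n \<omega> + R n \<omega>)) - iexp (t * U n \<omega>)) \<partial>M)"
      by (rule integral_norm_bound)
    also have "\<dots> \<le> (\<integral>\<omega>. \<bar>t\<bar> * \<delta> + 2 * indicator ?A \<omega> \<partial>M)"
    proof (rule integral_mono)
      show "integrable M (\<lambda>\<omega>. norm (iexp (t * (U n \<omega> + R n \<omega>)) - iexp (t * U n \<omega>)))"
        using i1 i2 by (intro integrable_norm Bochner_Integration.integrable_diff)
      show "integrable M (\<lambda>\<omega>. \<bar>t\<bar> * \<delta> + 2 * indicator ?A \<omega>)"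
        by (intro Bochner_Integration.integrable_add integrable_const integrable_mult_right)
          (simp add: emeasure_eq_measure)
      fix \<omega> assume \<omega>: "\<omega> \<in> space M"
      have "iexp (t * (U n \<omega> + R n \<omega>)) - iexp (t * U n \<omega>)
          = iexp (t * U n \<omega>) * (iexp (t * R n \<omega>) - 1)"
        by (simp add: exp_add[symmetric] algebra_simps)
      then have eq: "norm (iexp (t * (U n \<omega> + R n \<omega>)) - iexp (t * U n \<omega>)) = norm (iexp (t * R n \<omega>) - 1)"
        by (simp add: norm_mult)
      have "norm (iexp (t * R n \<omega>) - 1) \<le> \<bar>t\<bar> * \<bar>R n \<omega>\<bar>"
        using iexp_approx1[of "t * R n \<omega>" 0] by (simp add: abs_mult)
      moreover have "\<bar>t\<bar> * \<bar>R n \<omega>\<bar> \<le> \<bar>t\<bar> * \<delta>" if "\<omega> \<notin> ?A"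
        using that \<omega> by (intro mult_left_mono) auto
      moreover have "norm (iexp (t * R n \<omega>) - 1) \<le> 2"
        using norm_triangle_ineq4[of "iexp (t * R n \<omega>)" 1] by simp
      ultimately show "norm (iexp (t * (U n \<omega> + R n \<omega>)) - iexp (t * U n \<omega>))
          \<le> \<bar>t\<bar> * \<delta> + 2 * indicator ?A \<omega>"
        using \<open>\<delta> > 0\<close> unfolding eq by (cases "\<omega> \<in> ?A") (auto intro: add_increasing)
    qed
    also have "\<dots> = \<bar>t\<bar> * \<delta> + 2 * prob ?A"
      by (subst Bochner_Integration.integral_add)
        (auto simp: prob_space emeasure_eq_measure intro!: integrable_mult_right)
    finally show ?thesis .
  qed
  have "(\<lambda>n. char (distr M borel (\<lambda>\<omega>. U n \<omega> + R n \<omega>)) t - char (distr M borel (U n)) t) \<longlonglongrightarrow> 0"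
  proof (rule LIMSEQ_I)
    fix e :: real assume "e > 0"
    \<comment> \<open>The error \<open>e\<close> is split into
      \<open>\<bar>t\<bar> * \<delta> \<le> e / 2\<close> and twice a probability below
      \<open>e / 4\<close>; the summand 1 covers \<open>t = 0\<close>.\<close>
    define \<delta> where "\<delta> = e / (2 * (\<bar>t\<bar> + 1))"
    have "\<delta> > 0" using \<open>e > 0\<close> by (simp add: \<delta>_def add_nonneg_pos)
    have "\<bar>t\<bar> * \<delta> \<le> e / 2"
      using \<open>e > 0\<close> by (simp add: \<delta>_def field_simps)
    have "\<forall>\<^sub>F n in sequentially. prob {\<omega> \<in> space M. \<bar>R n \<omega>\<bar> > \<delta>} < e / 4"
      using order_tendstoD(2)[OF null[OF \<open>\<delta> > 0\<close>], of "e / 4"] \<open>e > 0\<close> by simp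
    then obtain n0 where n0: "\<And>n. n \<ge> n0 \<Longrightarrow> prob {\<omega> \<in> space M. \<bar>R n \<omega>\<bar> > \<delta>} < e / 4"
      unfolding eventually_sequentially by blast
    show "\<exists>no. \<forall>n\<ge>no. norm (char (distr M borel (\<lambda>\<omega>. U n \<omega> + R n \<omega>)) t
        - char (distr M borel (U n)) t - 0) < e"
    proof (intro exI[of _ n0] allI impI)
      fix n assume "n \<ge> n0"
      from n0[OF this] bnd[OF \<open>\<delta> > 0\<close>, of n] \<open>\<bar>t\<bar> * \<delta> \<le> e / 2\<close>
      show "norm (char (distr M borel (\<lambda>\<omega>. U n \<omega> + R n \<omega>)) t
        - char (distr M borel (U n)) t - 0) < e" by simp
    qed
  qed
  from tendsto_add[OF this charU]
  show "(\<lambda>n. char (distr M borel (\<lambda>\<omega>. U n \<omega> + R n \<omega>)) t) \<longlonglongrightarrow> char D t" by simp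
qed

text \<open>The order of choices matters: \<open>B\<close> from tightness, \<open>\<eta>\<close>
  from \<open>B\<close> and \<open>\<delta>\<close>, then \<open>K\<close> from
  \<open>\<eta>\<close>, and \<open>n\<close> last. Where \<open>T n \<omega> \<le> B\<close>, both
  terms of the bound are then at most \<open>\<delta> / 2\<close>, so a larger \<open>R\<close>
  forces \<open>T n \<omega> > B\<close>.\<close>

lemma (in prob_space) tendsto_prob_zero_if_tight_bound:
  fixes T R :: "nat \<Rightarrow> 'a \<Rightarrow> real"
  assumes T[measurable]: "\<And>n. n \<ge> 1 \<Longrightarrow> T n \<in> borel_measurable M"
    and tight: "\<And>\<epsilon>. \<epsilon> > 0 \<Longrightarrow> \<exists>B>0. \<forall>n\<ge>1. prob {\<omega> \<in> space M. T n \<omega> > B} < \<epsilon>"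
    and a: "a \<longlonglongrightarrow> 0" "\<And>n. 0 \<le> a n"
    and bound: "\<And>\<eta>. \<eta> > 0 \<Longrightarrow> \<exists>K\<ge>0. \<forall>n\<ge>1. AE \<omega> in M. \<bar>R n \<omega>\<bar> \<le> \<eta> * (1 + T n \<omega>) + K * a n * T n \<omega>"
    and "\<delta> > 0"
  shows "(\<lambda>n. prob {\<omega> \<in> space M. \<bar>R n \<omega>\<bar> > \<delta>}) \<longlonglongrightarrow> 0"
proof (rule LIMSEQ_I)
  fix e :: real assume "e > 0"
  then obtain B where B: "B > 0" "\<And>n. n \<ge> 1 \<Longrightarrow> prob {\<omega> \<in> space M. T n \<omega> > B} < e"
    using tight by blast
  define \<eta> where "\<eta> = (\<delta> / 2) / (1 + B)"
  have "1 + B > 0" using \<open>B > 0\<close> by simp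
  then have \<eta>: "\<eta> > 0" "\<eta> * (1 + B) = \<delta> / 2"
    using \<open>\<delta> > 0\<close> nonzero_eq_divide_eq[of "1 + B" \<eta> "\<delta> / 2"] by (simp_all add: \<eta>_def)
  obtain K where K: "K \<ge> 0"
    "\<And>n. n \<ge> 1 \<Longrightarrow> AE \<omega> in M. \<bar>R n \<omega>\<bar> \<le> \<eta> * (1 + T n \<omega>) + K * a n * T n \<omega>"
    using bound[OF \<eta>(1)] by blast
  have "(\<lambda>n. K * a n * B) \<longlonglongrightarrow> K * 0 * B"
    by (intro tendsto_intros a)
  then have "\<forall>\<^sub>F n in sequentially. K * a n * B < \<delta> / 2"
    using \<open>\<delta> > 0\<close> by (intro order_tendstoD(2)) auto
  then obtain n0 where n0: "\<And>n. n \<ge> n0 \<Longrightarrow> K * a n * B < \<delta> / 2"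
    unfolding eventually_sequentially by blast
  show "\<exists>no. \<forall>n\<ge>no. norm (prob {\<omega> \<in> space M. \<bar>R n \<omega>\<bar> > \<delta>} - 0) < e"
  proof (intro exI[of _ "max 1 n0"] allI impI)
    fix n assume n: "n \<ge> max 1 n0"
    have "AE \<omega> in M. \<omega> \<in> {\<omega> \<in> space M. \<bar>R n \<omega>\<bar> > \<delta>} \<longrightarrow> \<omega> \<in> {\<omega> \<in> space M. T n \<omega> > B}"
    proof -
      have "AE \<omega> in M. \<bar>R n \<omega>\<bar> \<le> \<eta> * (1 + T n \<omega>) + K * a n * T n \<omega>" using K n by simp
      then show ?thesis
      proof eventually_elim
        case (elim \<omega>)
        have "T n \<omega> > B" if "\<bar>R n \<omega>\<bar> > \<delta>"
        proof (rule ccontr)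
          assume "\<not> T n \<omega> > B"
          then have "\<eta> * (1 + T n \<omega>) \<le> \<eta> * (1 + B)" "K * a n * T n \<omega> \<le> K * a n * B"
            using \<eta>(1) K(1) a(2) by (auto intro!: mult_left_mono)
          with elim that \<eta>(2) n0[of n] n show False by simp
        qed
        then show ?case by simp
      qed
    qed
    then have "prob {\<omega> \<in> space M. \<bar>R n \<omega>\<bar> > \<delta>} \<le> prob {\<omega> \<in> space M. T n \<omega> > B}"
      using n by (intro finite_measure_mono_AE) (auto intro!: T)
    with B(2)[of n] n show "norm (prob {\<omega> \<in> space M. \<bar>R n \<omega>\<bar> > \<delta>} - 0) < e" by simp
  qed
qed

section \<open>Expansion of posterior expectations\<close>

text \<open>Within distance \<open>d\<close> of \<open>c\<close> the derivative gives the linear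
  term. Farther away the remainder is bounded by a constant \<open>B\<close> by compactness, and
  \<open>(norm (\<theta> - c) / d) powr s \<ge> 1\<close> lets the power term absorb
  \<open>B\<close>.\<close>

lemma differentiable_remainder_bound:
  fixes H :: "'a::euclidean_space \<Rightarrow> real"
  assumes "compact \<Theta>" and H: "continuous_on \<Theta> H"
    and der: "(H has_derivative (\<lambda>u. g \<bullet> u)) (at c within \<Theta>)"
    and "\<eta> > 0" and "s \<ge> 0"
  obtains K where "K \<ge> 0"
    "\<And>\<theta>. \<theta> \<in> \<Theta> \<Longrightarrow> \<bar>H \<theta> - H c - g \<bullet> (\<theta> - c)\<bar> \<le> \<eta> * norm (\<theta> - c) + K * norm (\<theta> - c) powr s"
proof -
  obtain d where d: "d > 0" "\<And>\<theta>. \<theta> \<in> \<Theta> \<Longrightarrow> norm (\<theta> - c) < d \<Longrightarrow>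
      \<bar>H \<theta> - H c - g \<bullet> (\<theta> - c)\<bar> \<le> \<eta> * norm (\<theta> - c)"
    using der \<open>\<eta> > 0\<close> unfolding has_derivative_within_alt by (auto simp: real_norm_def)
  have "compact ((\<lambda>\<theta>. H \<theta> - H c - g \<bullet> (\<theta> - c)) ` \<Theta>)"
    by (intro compact_continuous_image \<open>compact \<Theta>\<close> continuous_intros H)
  then obtain B where B: "B > 0" "\<And>\<theta>. \<theta> \<in> \<Theta> \<Longrightarrow> \<bar>H \<theta> - H c - g \<bullet> (\<theta> - c)\<bar> \<le> B"
    by (auto dest!: compact_imp_bounded simp: bounded_pos)
  show thesis
  proof (rule that)
    show "B / d powr s \<ge> 0" using B by simp
    fix \<theta> assume \<theta>: "\<theta> \<in> \<Theta>"
    show "\<bar>H \<theta> - H c - g \<bullet> (\<theta> - c)\<bar> \<le> \<eta> * norm (\<theta> - c) + B / d powr s * norm (\<theta> - c) powr s"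
    proof (cases "norm (\<theta> - c) < d")
      case True
      with d(2)[OF \<theta>] B show ?thesis by (auto intro: add_increasing2)
    next
      case False
      then have "d powr s \<le> norm (\<theta> - c) powr s"
        using d \<open>s \<ge> 0\<close> by (intro powr_mono2) auto
      then have "B \<le> B / d powr s * norm (\<theta> - c) powr s"
        using d B by (simp add: field_simps)
      with B(2)[OF \<theta>] \<open>\<eta> > 0\<close> show ?thesis by (auto intro: add_increasing)
    qed
  qed
qed

lemma integrable_borel_on_compact:
  fixes f :: "'a::topological_space \<Rightarrow> 'b::{banach, second_countable_topology}"
  assumes compact: "compact \<Theta>" and "prob_space M" and sets_M: "sets M = sets (borel_on \<Theta>)" and f: "continuous_on \<Theta> f"
  shows "integrable M f"
proof -
  interpret prob_space M by fact
  have "space M = \<Theta>" using sets_eq_imp_space_eq[OF sets_M] by (simp add: space_restrict_space)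
  moreover obtain B where "\<And>\<theta>. \<theta> \<in> \<Theta> \<Longrightarrow> norm (f \<theta>) \<le> B"
    using compact_imp_bounded[OF compact_continuous_image[OF f compact]] by (auto simp: bounded_iff)
  moreover have "f \<in> borel_measurable M"
    using borel_measurable_continuous_on_restrict[OF f] by (simp add: measurable_cong_sets[OF sets_M refl])
  ultimately show ?thesis by (intro integrable_const_bound[where B = B]) auto
qed

context
  fixes \<Theta> :: "'a::euclidean_space set" and H :: "'a \<Rightarrow> real" and g c :: 'a
  assumes compact: "compact \<Theta>" and cont: "continuous_on \<Theta> H"
    and der: "(H has_derivative (\<lambda>u. g \<bullet> u)) (at c within \<Theta>)"
begin

text \<open>The constant \<open>K\<close> is fixed before \<open>M\<close> and \<open>n\<close>, so
  that one \<open>K\<close> serves the posteriors of all data and all sample sizes. The bound is the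
  pointwise remainder estimate with exponent \<open>1 + \<gamma>\<close>, scaled by
  \<open>sqrt (real n)\<close> and integrated.\<close>

lemma expectation_remainder_bound:
  assumes "\<eta> > 0" and "\<gamma> > 0"
  obtains K where "K \<ge> 0"
    "\<And>M n. prob_space M \<Longrightarrow> sets M = sets (borel_on \<Theta>) \<Longrightarrow> n \<ge> 1 \<Longrightarrow>
      \<bar>sqrt (real n) * ((\<integral>\<theta>. H \<theta> \<partial>M) - H c) - g \<bullet> (sqrt (real n) *\<^sub>R ((\<integral>\<theta>. \<theta> \<partial>M) - c))\<bar>
      \<le> \<eta> * (1 + (\<integral>\<theta>. norm (sqrt (real n) *\<^sub>R (\<theta> - c)) powr (1 + \<gamma>) \<partial>M))
        + K * real n powr (- \<gamma> / 2) * (\<integral>\<theta>. norm (sqrt (real n) *\<^sub>R (\<theta> - c)) powr (1 + \<gamma>) \<partial>M)"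
proof -
  have "1 + \<gamma> \<ge> 0" using assms by simp
  then obtain K where K: "K \<ge> 0"
    "\<And>\<theta>. \<theta> \<in> \<Theta> \<Longrightarrow> \<bar>H \<theta> - H c - g \<bullet> (\<theta> - c)\<bar> \<le> \<eta> * norm (\<theta> - c) + K * norm (\<theta> - c) powr (1 + \<gamma>)"
    using differentiable_remainder_bound[OF compact cont der \<open>\<eta> > 0\<close>] by metis
  show thesis
  proof (rule that[OF K(1)])
    fix M :: "'a measure" and n :: nat
    assume M: "prob_space M" and sets_M: "sets M = sets (borel_on \<Theta>)" and n: "n \<ge> 1"
    interpret prob_space M by fact
    have sp: "space M = \<Theta>" using sets_eq_imp_space_eq[OF sets_M] by (simp add: space_restrict_space)
    define r where "r = sqrt (real n)"
    have "r > 0" using n by (simp add: r_def)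
    define T where "T \<theta> = norm (r *\<^sub>R (\<theta> - c)) powr (1 + \<gamma>)" for \<theta>
    note int = integrable_borel_on_compact[OF compact M sets_M]
    have iH: "integrable M H" and iid: "integrable M (\<lambda>\<theta>. \<theta>)" and iT: "integrable M T"
      unfolding T_def by (intro int cont continuous_on_id continuous_on_powr' continuous_intros; use assms in auto)+
    have "r * ((\<integral>\<theta>. H \<theta> \<partial>M) - H c) - g \<bullet> (r *\<^sub>R ((\<integral>\<theta>. \<theta> \<partial>M) - c))
      = (\<integral>\<theta>. r * (H \<theta> - H c - g \<bullet> (\<theta> - c)) \<partial>M)"
      using iH iid by (simp add: prob_space inner_diff_right algebra_simps)
    also have "\<bar>\<dots>\<bar> \<le> (\<integral>\<theta>. \<bar>r * (H \<theta> - H c - g \<bullet> (\<theta> - c))\<bar> \<partial>M)"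
      by (rule integral_abs_bound)
    also have "\<dots> \<le> (\<integral>\<theta>. \<eta> * (1 + T \<theta>) + K * real n powr (- \<gamma> / 2) * T \<theta> \<partial>M)"
    proof (rule integral_mono)
      show "integrable M (\<lambda>\<theta>. \<bar>r * (H \<theta> - H c - g \<bullet> (\<theta> - c))\<bar>)"
        by (intro int continuous_intros cont)
      show "integrable M (\<lambda>\<theta>. \<eta> * (1 + T \<theta>) + K * real n powr (- \<gamma> / 2) * T \<theta>)"
        using iT by simp
      fix \<theta> assume "\<theta> \<in> space M"
      define d where "d = norm (\<theta> - c)"
      have "d \<ge> 0" by (simp add: d_def)
      have T: "T \<theta> = (r * d) powr (1 + \<gamma>)" using \<open>r > 0\<close> by (simp add: T_def d_def)
      \<comment> \<open>For \<open>t \<ge> 0\<close>,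
        \<open>t \<le> 1 + t powr (1 + \<gamma>)\<close>: either \<open>t \<le> 1\<close>, or the
        power dominates.\<close>
      have "r * d \<le> 1 + T \<theta>"
      proof (cases "r * d \<le> 1")
        case False
        then have "(r * d) powr 1 \<le> (r * d) powr (1 + \<gamma>)" using assms by (intro powr_mono) auto
        then show ?thesis using False by (simp add: T)
      qed (simp add: T add_increasing2)
      moreover have "r * d powr (1 + \<gamma>) = real n powr (- \<gamma> / 2) * T \<theta>"
      proof -
        have "real n powr (- \<gamma> / 2) = r powr (- \<gamma>)"
          using n by (simp add: r_def powr_half_sqrt[symmetric] powr_powr)
        then show ?thesis
          using \<open>r > 0\<close> \<open>d \<ge> 0\<close> by (simp add: T powr_mult flip: powr_add mult.assoc)
      qed
      moreover have "\<bar>r * (H \<theta> - H c - g \<bullet> (\<theta> - c))\<bar> \<le> r * (\<eta> * d + K * d powr (1 + \<gamma>))"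
        using K(2)[of \<theta>] \<open>\<theta> \<in> space M\<close> \<open>r > 0\<close> by (simp add: sp abs_mult d_def)
      ultimately show "\<bar>r * (H \<theta> - H c - g \<bullet> (\<theta> - c))\<bar>
          \<le> \<eta> * (1 + T \<theta>) + K * real n powr (- \<gamma> / 2) * T \<theta>"
        using mult_left_mono[of "r * d" "1 + T \<theta>" \<eta>] \<open>\<eta> > 0\<close> by (simp add: algebra_simps)
    qed
    also have "\<dots> = \<eta> * (1 + (\<integral>\<theta>. T \<theta> \<partial>M)) + K * real n powr (- \<gamma> / 2) * (\<integral>\<theta>. T \<theta> \<partial>M)"
      using iT by (simp add: prob_space)
    finally show "\<bar>sqrt (real n) * ((\<integral>\<theta>. H \<theta> \<partial>M) - H c) - g \<bullet> (sqrt (real n) *\<^sub>R ((\<integral>\<theta>. \<theta> \<partial>M) - c))\<bar>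
      \<le> \<eta> * (1 + (\<integral>\<theta>. norm (sqrt (real n) *\<^sub>R (\<theta> - c)) powr (1 + \<gamma>) \<partial>M))
        + K * real n powr (- \<gamma> / 2) * (\<integral>\<theta>. norm (sqrt (real n) *\<^sub>R (\<theta> - c)) powr (1 + \<gamma>) \<partial>M)"
      by (simp only: r_def T_def)
  qed
qed

text \<open>The variance is at most the second moment of \<open>H\<close> about \<open>H c\<close>,
  and \<open>H\<close> deviates from \<open>H c\<close> at most linearly in the distance to
  \<open>c\<close> on all of \<open>\<Theta>\<close>. The rate comes from
  \<open>sqrt n = n powr (- 1 / 2) * n\<close>, where the factor \<open>n\<close> rescales the
  squared distance.\<close>

lemma variance_bound:
  obtains L where "L \<ge> 0"
    "\<And>M n. prob_space M \<Longrightarrow> sets M = sets (borel_on \<Theta>) \<Longrightarrow> n \<ge> 1 \<Longrightarrow>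
      sqrt (real n) * variance_under M H
      \<le> L * real n powr (- 1 / 2) * (\<integral>\<theta>. norm (sqrt (real n) *\<^sub>R (\<theta> - c)) powr 2 \<partial>M)"
proof -
  obtain K where K: "K \<ge> 0" "\<And>\<theta>. \<theta> \<in> \<Theta> \<Longrightarrow>
      \<bar>H \<theta> - H c - g \<bullet> (\<theta> - c)\<bar> \<le> 1 * norm (\<theta> - c) + K * norm (\<theta> - c) powr 1"
    \<comment> \<open>With exponent 1 both error terms are linear, which gives the growth constant
      \<open>L\<close> below.\<close>
    using differentiable_remainder_bound[OF compact cont der, of 1 1] by auto
  define L where "L = norm g + 1 + K"
  have L: "\<bar>H \<theta> - H c\<bar> \<le> L * norm (\<theta> - c)" if "\<theta> \<in> \<Theta>" for \<theta>
    using K(2)[OF that] Cauchy_Schwarz_ineq2[of g "\<theta> - c"] by (simp add: L_def algebra_simps)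
  show thesis
  proof (rule that)
    show "L\<^sup>2 \<ge> 0" by simp
    fix M :: "'a measure" and n :: nat
    assume M: "prob_space M" and sets_M: "sets M = sets (borel_on \<Theta>)" and n: "n \<ge> 1"
    interpret prob_space M by fact
    have sp: "space M = \<Theta>" using sets_eq_imp_space_eq[OF sets_M] by (simp add: space_restrict_space)
    note int = integrable_borel_on_compact[OF compact M sets_M]
    define m where "m = (\<integral>\<theta>. H \<theta> \<partial>M)"
    have iH: "integrable M H" by (intro int cont)
    \<comment> \<open>The second moments about \<open>H c\<close> and about the mean
      \<open>m\<close> differ by the square of \<open>m - H c\<close>.\<close>
    have "(\<integral>\<theta>. (H \<theta> - H c)\<^sup>2 \<partial>M) - variance_under M H = (\<integral>\<theta>. (H \<theta> - H c)\<^sup>2 - (H \<theta> - m)\<^sup>2 \<partial>M)"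
      unfolding variance_under_def m_def[symmetric]
      by (rule Bochner_Integration.integral_diff[symmetric]; intro int continuous_intros cont)
    also have "\<dots> = (\<integral>\<theta>. 2 * (m - H c) * H \<theta> + ((H c)\<^sup>2 - m\<^sup>2) \<partial>M)"
      by (intro Bochner_Integration.integral_cong) (simp_all add: power2_eq_square algebra_simps)
    also have "\<dots> = (m - H c)\<^sup>2"
      using iH by (simp add: prob_space m_def[symmetric]) (simp add: power2_eq_square algebra_simps)
    finally have "variance_under M H \<le> (\<integral>\<theta>. (H \<theta> - H c)\<^sup>2 \<partial>M)"
      using zero_le_power2[of "m - H c"] by linarith
    also have "\<dots> \<le> (\<integral>\<theta>. L\<^sup>2 * norm (\<theta> - c) ^ 2 \<partial>M)"
    proof (rule integral_mono)
      fix \<theta> assume "\<theta> \<in> space M"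
      then show "(H \<theta> - H c)\<^sup>2 \<le> L\<^sup>2 * norm (\<theta> - c) ^ 2"
        using power_mono[OF L, of \<theta> 2] by (simp add: sp power_mult_distrib)
    qed (intro int continuous_intros cont)+
    finally have "sqrt (real n) * variance_under M H
        \<le> sqrt (real n) * (\<integral>\<theta>. L\<^sup>2 * norm (\<theta> - c) ^ 2 \<partial>M)"
      by (intro mult_left_mono) auto
    also have "\<dots> = L\<^sup>2 * (sqrt (real n) * (\<integral>\<theta>. norm (\<theta> - c) ^ 2 \<partial>M))" by simp
    also have "\<dots> = L\<^sup>2 * (real n powr (- 1 / 2) * real n * (\<integral>\<theta>. norm (\<theta> - c) ^ 2 \<partial>M))"
      using n powr_add[of "real n" "- 1 / 2" 1] by (simp add: powr_half_sqrt)
    also have "L\<^sup>2 * (real n powr (- 1 / 2) * real n * (\<integral>\<theta>. norm (\<theta> - c) ^ 2 \<partial>M))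
      = L\<^sup>2 * real n powr (- 1 / 2) * (\<integral>\<theta>. real n * norm (\<theta> - c) ^ 2 \<partial>M)" by simp
    also have "(\<lambda>\<theta>. real n * norm (\<theta> - c) ^ 2) = (\<lambda>\<theta>. norm (sqrt (real n) *\<^sub>R (\<theta> - c)) powr 2)"
      by (simp add: power_mult_distrib)
    finally show "sqrt (real n) * variance_under M H
      \<le> L\<^sup>2 * real n powr (- 1 / 2) * (\<integral>\<theta>. norm (sqrt (real n) *\<^sub>R (\<theta> - c)) powr 2 \<partial>M)" .
  qed
qed

end

theorem theorem4p1:
  fixes \<Theta> :: "(real^'l) set" and prior :: "(real^'l) measure" and \<theta>c :: "real^'l"
    and \<Xi> :: "(real^'m) set" and P :: "real^'l \<Rightarrow> (real^'m) measure"
    and X :: "(real^'d) set" and h :: "real^'d \<Rightarrow> real^'m \<Rightarrow> real" and x :: "real^'d"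
    and \<nu> :: "nat \<Rightarrow> (nat \<Rightarrow> real^'m) measure"
    and p :: "nat \<Rightarrow> real^'l \<Rightarrow> (nat \<Rightarrow> real^'m) \<Rightarrow> real"
    and J :: "real^'l^'l" and gradH :: "real^'l"
  assumes "sets prior = sets (borel_on \<Theta>)" and "prob_space prior"
    and "\<And>\<theta>. \<theta> \<in> \<Theta> \<Longrightarrow> sets (P \<theta>) = sets (borel_on \<Xi>)"
    and "\<And>\<theta>. \<theta> \<in> \<Theta> \<Longrightarrow> prob_space (P \<theta>)"
    and "\<And>B. B \<in> sets (\<Pi>\<^sub>M i\<in>(UNIV :: nat set). borel_on \<Xi>) \<Longrightarrow>
           (\<lambda>\<theta>. emeasure (iid_seq P \<theta>) B) \<in> borel_measurable (borel_on \<Theta>)"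
    and "\<theta>c \<in> \<Theta>"
    and "closed X" and "x \<in> X"
    and "\<And>x' \<theta>. x' \<in> X \<Longrightarrow> \<theta> \<in> \<Theta> \<Longrightarrow> integrable (P \<theta>) (h x')"
    and i: "compact \<Theta>"
    and ii: "\<And>n. n \<ge> 1 \<Longrightarrow> sets (\<nu> n) = sets (\<Pi>\<^sub>M i\<in>{..<n}. borel_on \<Xi>)"
      "\<And>n. n \<ge> 1 \<Longrightarrow> sigma_finite_measure (\<nu> n)"
      "\<And>n. n \<ge> 1 \<Longrightarrow> (\<lambda>(\<theta>, y). p n \<theta> y) \<in>
         borel_measurable (borel_on \<Theta> \<Otimes>\<^sub>M (\<Pi>\<^sub>M i\<in>{..<n}. borel_on \<Xi>))"
      "\<And>n \<theta> y. n \<ge> 1 \<Longrightarrow> \<theta> \<in> \<Theta> \<Longrightarrow> y \<in> space (\<nu> n) \<Longrightarrow> 0 \<le> p n \<theta> y"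
      "\<And>n \<theta>. n \<ge> 1 \<Longrightarrow> \<theta> \<in> \<Theta> \<Longrightarrow> iid_n P n \<theta> = density (\<nu> n) (\<lambda>y. ennreal (p n \<theta> y))"
    and iii: "\<And>V. borel_nhd \<Theta> \<theta>c V \<Longrightarrow>
      \<exists>\<phi>. uniformly_consistent_tests (borel_on \<Xi>) P \<theta>c (\<Theta> - V) \<phi>"
    and iv: "\<And>\<epsilon> V. (0::real) < \<epsilon> \<Longrightarrow> borel_nhd \<Theta> \<theta>c V \<Longrightarrow>
      \<exists>W \<in> sets prior. W \<subseteq> V \<and> measure prior W > 0 \<and> (\<forall>\<theta>\<in>W. KL (P \<theta>c) (P \<theta>) < ereal \<epsilon>)"
    and v: "\<exists>\<gamma>>0. post_moment_tight (iid_seq P \<theta>c) (posterior prior p) \<theta>c \<gamma>"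
    and vi: "has_fisher_information \<Theta> \<theta>c (iid_n P 1 \<theta>c) (p 1) J"
      "invertible J"
      "bernstein_von_mises (borel_on \<Xi>) (iid_seq P \<theta>c) (posterior prior p) \<theta>c (matrix_inv J)"
      "weak_conv_vec
         (\<lambda>n. distr (iid_seq P \<theta>c) borel
            (\<lambda>\<omega>. sqrt (real n) *\<^sub>R ((\<integral>\<theta>. \<theta> \<partial>posterior prior p n \<omega>) - \<theta>c)))
         (mvnormal 0 (matrix_inv J))"
    and "continuous_on \<Theta> (expected_cost P h x)"
    and "(expected_cost P h x has_derivative (\<lambda>u. gradH \<bullet> u)) (at \<theta>c within \<Theta>)"
  shows "weak_conv_m
      (\<lambda>n. distr (iid_seq P \<theta>c) borel
         (\<lambda>\<omega>. sqrt (real n) *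
            ((\<integral>\<theta>. expected_cost P h x \<theta> \<partial>posterior prior p n \<omega>) - expected_cost P h x \<theta>c)))
      (normal_law 0 (gradH \<bullet> (matrix_inv J *v gradH)))
    \<and> (post_moment_tight (iid_seq P \<theta>c) (posterior prior p) \<theta>c 1 \<longrightarrow>
       (\<forall>w\<ge>0. weak_conv_m
          (\<lambda>n. distr (iid_seq P \<theta>c) borel
             (\<lambda>\<omega>. sqrt (real n) *
                ((\<integral>\<theta>. expected_cost P h x \<theta> \<partial>posterior prior p n \<omega>)
                 + w * variance_under (posterior prior p n \<omega>) (expected_cost P h x)
                 - expected_cost P h x \<theta>c)))
          (normal_law 0 (gradH \<bullet> (matrix_inv J *v gradH)))))"
proof -

  \<comment> \<open>Measurability of the model and of posterior integrals\<close>
  interpret \<pi>: prob_space prior by fact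
  define N :: "(real^'m) measure" where "N = borel_on \<Xi>"
  define Q where "Q = iid_seq P \<theta>c"
  define post where "post = posterior prior p"
  define H where "H = expected_cost P h x"
  note cH = assms(23)[folded H_def] and dH = assms(24)[folded H_def]
  note int_bound = expectation_remainder_bound[OF i cH dH]
  have space_prior: "space prior = \<Theta>"
    using sets_eq_imp_space_eq[OF assms(1)] by (simp add: space_restrict_space)
  have PN: "sets (P \<theta>) = sets N" if "\<theta> \<in> \<Theta>" for \<theta>
    using assms(3) that by (simp add: N_def)
  interpret Pc: product_prob_space "\<lambda>_. P \<theta>c" "UNIV :: nat set"
    by (intro product_prob_spaceI assms(4) \<open>\<theta>c \<in> \<Theta>\<close>)
  interpret Q: prob_space Q unfolding Q_def by (rule prob_space_PiM) (rule assms(4)[OF \<open>\<theta>c \<in> \<Theta>\<close>])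
  have sets_Q[measurable_cong]: "sets Q = sets (\<Pi>\<^sub>M i\<in>UNIV. N)"
    unfolding Q_def by (intro sets_PiM_cong PN \<open>\<theta>c \<in> \<Theta>\<close> refl)
  have p_meas: "(\<lambda>(\<theta>, y). p n \<theta> y) \<in> borel_measurable (prior \<Otimes>\<^sub>M (\<Pi>\<^sub>M i\<in>{..<n}. N))" if "n \<ge> 1" for n
    using ii(3)[OF that] by (simp add: N_def measurable_cong_sets[OF sets_pair_measure_cong[OF assms(1) refl] refl])
  have post_meas: "(\<lambda>\<omega>. \<integral>\<theta>. G \<theta> \<omega> \<partial>post n \<omega>) \<in> borel_measurable Q"
    if "n \<ge> 1" "(\<lambda>(\<omega>, \<theta>). G \<theta> \<omega>) \<in> borel_measurable ((\<Pi>\<^sub>M i\<in>UNIV. N) \<Otimes>\<^sub>M prior)"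
    for n and G :: "real^'l \<Rightarrow> (nat \<Rightarrow> real^'m) \<Rightarrow> 'b::{banach, second_countable_topology}"
    unfolding post_def measurable_cong_sets[OF sets_Q refl]
    using that by (intro posterior_integral_measurable \<open>prob_space prior\<close> p_meas)

  \<comment> \<open>The posterior is almost surely a probability measure\<close>
  have post_prob: "AE \<omega> in Q. prob_space (post n \<omega>)" if n: "n \<ge> 1" for n
  proof -
    \<comment> \<open>The divergence condition is applied with the neighborhood
      \<open>\<Theta>\<close> and the bound 1: any finite value of \<open>KL\<close> already
      contains absolute continuity, as \<open>KL\<close> is infinite otherwise.\<close>
    have nhd: "borel_nhd \<Theta> \<theta>c \<Theta>"
    proof -
      have "space prior \<in> sets prior" by (rule sets.top)
      then show ?thesis
        unfolding borel_nhd_def space_prior assms(1) by (auto intro!: exI[of _ UNIV])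
    qed
    then obtain W where W: "W \<in> sets prior" "measure prior W > 0" "W \<subseteq> \<Theta>"
      and KL: "\<And>\<theta>. \<theta> \<in> W \<Longrightarrow> KL (P \<theta>c) (P \<theta>) < ereal 1"
      using iv[OF zero_less_one nhd] by auto
    have sets_eq: "sets (\<nu> n) = sets (\<Pi>\<^sub>M i\<in>{..<n}. N)" using ii(1)[OF n] by (simp add: N_def)
    have f: "(\<lambda>(\<theta>, y). p n \<theta> y) \<in> borel_measurable (prior \<Otimes>\<^sub>M \<nu> n)"
      using p_meas[OF n] by (simp add: measurable_cong_sets[OF sets_pair_measure_cong[OF refl sets_eq] refl])
    define Z where "Z y = (\<integral>\<^sup>+\<theta>. ennreal (p n \<theta> y) \<partial>prior)" for y
    have "AE y in density (\<nu> n) (\<lambda>y. ennreal (p n \<theta>c y)). Z y \<noteq> 0 \<and> Z y \<noteq> \<infinity>"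
      unfolding Z_def
    proof (rule evidence_pos_finite_AE[OF \<open>prob_space prior\<close> ii(2)[OF n] f _ _ W(1,2)])
      show "prob_space (density (\<nu> n) (\<lambda>y. ennreal (p n \<theta> y)))" if "\<theta> \<in> space prior" for \<theta>
        using that unfolding space_prior
        by (subst ii(5)[OF n, symmetric]) (auto intro!: prob_space_PiM assms(4))
      show "\<theta>c \<in> space prior" using \<open>\<theta>c \<in> \<Theta>\<close> by (simp add: space_prior)
      fix \<theta> assume "\<theta> \<in> W"
      then have \<theta>: "\<theta> \<in> \<Theta>" using W by blast
      have "absolutely_continuous (P \<theta>) (P \<theta>c)"
        using KL[OF \<open>\<theta> \<in> W\<close>] by (auto simp: KL_def split: if_splits)
      then have "absolutely_continuous (iid_n P n \<theta>) (iid_n P n \<theta>c)"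
        by (intro absolutely_continuous_PiM_finite assms(4) \<theta> \<open>\<theta>c \<in> \<Theta>\<close>)
          (simp_all add: PN \<theta> \<open>\<theta>c \<in> \<Theta>\<close>)
      then show "absolutely_continuous (density (\<nu> n) (\<lambda>y. ennreal (p n \<theta> y)))
          (density (\<nu> n) (\<lambda>y. ennreal (p n \<theta>c y)))"
        by (simp add: ii(5)[OF n \<theta>] ii(5)[OF n \<open>\<theta>c \<in> \<Theta>\<close>])
    qed
    \<comment> \<open>The law of the first \<open>n\<close> observations is the image of the
      sequence law under restriction, so the statement lifts to data sequences.\<close>
    then have "AE y in distr Q (iid_n P n \<theta>c) (\<lambda>\<omega>. restrict \<omega> {..<n}). Z y \<noteq> 0 \<and> Z y \<noteq> \<infinity>"
      unfolding Q_def Pc.distr_PiM_restrict_finite[of "{..<n}", OF finite_lessThan subset_UNIV]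
      unfolding ii(5)[OF n \<open>\<theta>c \<in> \<Theta>\<close>] .
    then have "AE \<omega> in Q. Z (restrict \<omega> {..<n}) \<noteq> 0 \<and> Z (restrict \<omega> {..<n}) \<noteq> \<infinity>"
      by (rule AE_distrD[rotated]) (auto simp: Q_def intro!: measurable_restrict_subset)
    then show ?thesis
    proof (rule AE_mp, intro AE_I2 impI)
      fix \<omega> assume \<omega>: "\<omega> \<in> space Q" and Z: "Z (restrict \<omega> {..<n}) \<noteq> 0 \<and> Z (restrict \<omega> {..<n}) \<noteq> \<infinity>"
      have "restrict \<omega> {..<n} \<in> space (\<Pi>\<^sub>M i\<in>{..<n}. N)"
        using \<omega> unfolding sets_eq_imp_space_eq[OF sets_Q] by (auto simp: space_PiM)
      then have "(\<lambda>\<theta>. p n \<theta> (restrict \<omega> {..<n})) \<in> borel_measurable prior"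
        using measurable_Pair1[OF p_meas[OF n]] by simp
      then show "prob_space (post n \<omega>)"
        unfolding post_def using Z by (intro prob_space_posterior) (simp_all add: Z_def)
    qed
  qed
  have sets_post: "sets (post n \<omega>) = sets (borel_on \<Theta>)" for n \<omega>
    by (simp add: post_def posterior_def assms(1))

  \<comment> \<open>The Gaussian limit of the linear term\<close>
  define S where "S = gradH \<bullet> (matrix_inv J *v gradH)"
  define Zn where "Zn n \<omega> = sqrt (real n) *\<^sub>R ((\<integral>\<theta>. \<theta> \<partial>post n \<omega>) - \<theta>c)" for n \<omega>
  have id_meas[measurable]: "(\<lambda>\<theta>. \<theta>) \<in> borel_measurable prior"
    by (simp add: measurable_cong_sets[OF assms(1) refl] measurable_restrict_space1)
  have H_meas[measurable]: "H \<in> borel_measurable prior"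
    using borel_measurable_continuous_on_restrict[OF cH] by (simp add: measurable_cong_sets[OF assms(1) refl])
  have Zn_meas[measurable]: "Zn n \<in> borel_measurable Q" for n
  \<comment> \<open>The densities are controlled only for \<open>n \<ge> 1\<close>; at
    \<open>n = 0\<close> the factor \<open>sqrt 0\<close> makes the variable constant.\<close>
  proof (cases "n = 0")
    case False
    have "(\<lambda>\<omega>. \<integral>\<theta>. \<theta> \<partial>post n \<omega>) \<in> borel_measurable Q"
      using False by (intro post_meas) (simp_all add: measurable_compose[OF measurable_snd id_meas] case_prod_beta')
    then show ?thesis unfolding Zn_def[abs_def] by measurable
  qed (simp add: Zn_def[abs_def])
  define mvn where "mvn = mvnormal 0 (matrix_inv J)"
  have wZ: "weak_conv_vec (\<lambda>n. distr Q borel (Zn n)) mvn"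
    using vi(4) by (simp add: Zn_def[abs_def] Q_def post_def mvn_def)
  have prob_distr: "prob_space (distr Q borel (Zn n))" for n
    by (intro Q.prob_space_distr) measurable
  \<comment> \<open>So the normalizing constant of \<^const>\<open>mvnormal\<close> is correct without computing a Gaussian integral.\<close>
  have prob_mvn: "prob_space mvn"
    by (rule weak_conv_vec_prob_space[OF wZ prob_distr])
  have normal: "distr mvn borel ((\<bullet>) gradH) = normal_law 0 S"
    unfolding mvn_def S_def using prob_mvn
    by (intro distr_inner_mvnormal vi(2) has_fisher_information_transpose[OF vi(1)]
        has_fisher_information_nonneg[OF vi(1)]) (simp add: mvn_def)
  have sets_mvn: "sets mvn = sets borel" by (simp add: mvn_def mvnormal_def)
  have real_normal: "real_distribution (normal_law 0 S)"
    unfolding normal[symmetric]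
    by (intro prob_space.real_distribution_distr prob_mvn) (simp add: measurable_cong_sets[OF sets_mvn refl])
  have "weak_conv_m (\<lambda>n. distr (distr Q borel (Zn n)) borel ((\<bullet>) gradH)) (normal_law 0 S)"
    unfolding normal[symmetric] by (rule weak_conv_vec_inner[OF wZ prob_distr _ sets_mvn]) simp
  then have wU: "weak_conv_m (\<lambda>n. distr Q borel (\<lambda>\<omega>. gradH \<bullet> Zn n \<omega>)) (normal_law 0 S)"
    by (simp add: distr_distr comp_def)

  \<comment> \<open>The remainder, with and without the variance term\<close>
  have main: "weak_conv_m (\<lambda>n. distr Q borel (\<lambda>\<omega>. sqrt (real n) *
      ((\<integral>\<theta>. H \<theta> \<partial>post n \<omega>) + w * variance_under (post n \<omega>) H - H \<theta>c))) (normal_law 0 S)"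
    if "\<gamma> > 0" and tight: "post_moment_tight Q post \<theta>c \<gamma>" and "w \<ge> 0" and w: "w = 0 \<or> \<gamma> = 1"
    for \<gamma> w
  proof -
    define Y where "Y n \<omega> = sqrt (real n) *
      ((\<integral>\<theta>. H \<theta> \<partial>post n \<omega>) + w * variance_under (post n \<omega>) H - H \<theta>c)" for n \<omega>
    define T where "T n \<omega> = (\<integral>\<theta>. norm (sqrt (real n) *\<^sub>R (\<theta> - \<theta>c)) powr (1 + \<gamma>) \<partial>post n \<omega>)" for n \<omega>
    have [measurable]: "Y n \<in> borel_measurable Q" for n
    proof (cases "n = 0")
      case False
      then have n: "n \<ge> 1" by simp
      have m[measurable]: "(\<lambda>\<omega>. \<integral>\<theta>. H \<theta> \<partial>post n \<omega>) \<in> borel_measurable Q"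
        by (rule post_meas[OF n]) measurable
      \<comment> \<open>The integrand of the variance contains the posterior mean as a function of
        the data, so measurability of the mean is restated over the product sigma-algebra that
        \<open>post_meas\<close> expects.\<close>
      note [measurable] = m[unfolded measurable_cong_sets[OF sets_Q refl]]
      have [measurable]: "(\<lambda>\<omega>. variance_under (post n \<omega>) H) \<in> borel_measurable Q"
        unfolding variance_under_def by (rule post_meas[OF n]) measurable
      show ?thesis unfolding Y_def[abs_def] by measurable
    qed (simp add: Y_def[abs_def])
    have T_meas: "T n \<in> borel_measurable Q" if "n \<ge> 1" for n
      unfolding T_def[abs_def] by (rule post_meas[OF that]) measurable
    \<comment> \<open>\<open>R\<close> collects the expansion error of the posterior mean of
      \<open>H\<close> and the scaled variance term.\<close>
    define R where "R n \<omega> = Y n \<omega> - gradH \<bullet> Zn n \<omega>" for n \<omega>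
    have [measurable]: "R n \<in> borel_measurable Q" for n unfolding R_def[abs_def] by measurable
    have "(\<lambda>n. Q.prob {\<omega> \<in> space Q. \<bar>R n \<omega>\<bar> > \<delta>}) \<longlonglongrightarrow> 0" if "\<delta> > 0" for \<delta>
    proof (rule Q.tendsto_prob_zero_if_tight_bound[OF T_meas, where a = "\<lambda>n. real n powr (- \<gamma> / 2)"])
      show "\<exists>B>0. \<forall>n\<ge>1. Q.prob {\<omega> \<in> space Q. T n \<omega> > B} < \<epsilon>" if "\<epsilon> > 0" for \<epsilon>
        using tight that unfolding post_moment_tight_def T_def by blast
      show "(\<lambda>n. real n powr (- \<gamma> / 2)) \<longlonglongrightarrow> 0"
        using \<open>\<gamma> > 0\<close> by (intro tendsto_neg_powr filterlim_real_sequentially) simp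
      fix \<eta> :: real assume "\<eta> > 0"
      obtain K where K: "K \<ge> 0" "\<And>M n. prob_space M \<Longrightarrow> sets M = sets (borel_on \<Theta>) \<Longrightarrow> n \<ge> 1 \<Longrightarrow>
      \<bar>sqrt (real n) * ((\<integral>\<theta>. H \<theta> \<partial>M) - H \<theta>c) - gradH \<bullet> (sqrt (real n) *\<^sub>R ((\<integral>\<theta>. \<theta> \<partial>M) - \<theta>c))\<bar>
      \<le> \<eta> * (1 + (\<integral>\<theta>. norm (sqrt (real n) *\<^sub>R (\<theta> - \<theta>c)) powr (1 + \<gamma>) \<partial>M))
        + K * real n powr (- \<gamma> / 2) * (\<integral>\<theta>. norm (sqrt (real n) *\<^sub>R (\<theta> - \<theta>c)) powr (1 + \<gamma>) \<partial>M)"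
        using int_bound[OF \<open>\<eta> > 0\<close> \<open>\<gamma> > 0\<close>] by blast
      obtain L where L: "L \<ge> 0" "\<And>M n. prob_space M \<Longrightarrow> sets M = sets (borel_on \<Theta>) \<Longrightarrow> n \<ge> 1 \<Longrightarrow>
        sqrt (real n) * variance_under M H
        \<le> L * real n powr (- 1 / 2) * (\<integral>\<theta>. norm (sqrt (real n) *\<^sub>R (\<theta> - \<theta>c)) powr 2 \<partial>M)"
        using variance_bound[OF i cH dH] by blast
      show "\<exists>K\<ge>0. \<forall>n\<ge>1. AE \<omega> in Q. \<bar>R n \<omega>\<bar> \<le> \<eta> * (1 + T n \<omega>) + K * real n powr (- \<gamma> / 2) * T n \<omega>"
      \<comment> \<open>\<open>K\<close> pays for the expansion error and \<open>w * L\<close> for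
        the variance. The latter vanishes for \<open>w = 0\<close>; for \<open>\<gamma> = 1\<close>
        its rate \<open>- 1 / 2\<close> and moment 2 are exactly \<open>- \<gamma> / 2\<close> and
        \<open>1 + \<gamma>\<close>.\<close>
      proof (intro exI[of _ "K + w * L"] conjI allI impI)
        show "K + w * L \<ge> 0" using K L \<open>w \<ge> 0\<close> by simp
        fix n :: nat assume n: "n \<ge> 1"
        from post_prob[OF n]
        show "AE \<omega> in Q. \<bar>R n \<omega>\<bar> \<le> \<eta> * (1 + T n \<omega>) + (K + w * L) * real n powr (- \<gamma> / 2) * T n \<omega>"
        proof eventually_elim
          case (elim \<omega>)
          define V where "V = w * (sqrt (real n) * variance_under (post n \<omega>) H)"
          have "variance_under (post n \<omega>) H \<ge> 0" by (simp add: variance_under_def)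
          then have "V \<ge> 0" unfolding V_def using \<open>w \<ge> 0\<close> by simp
          have V: "V \<le> w * L * real n powr (- \<gamma> / 2) * T n \<omega>"
            using w
          proof
            assume "\<gamma> = 1"
            then show ?thesis
              using mult_left_mono[OF L(2)[OF elim sets_post n] \<open>w \<ge> 0\<close>]
              by (simp add: V_def T_def mult.assoc)
          qed (simp add: V_def)
          have "R n \<omega> = (sqrt (real n) * ((\<integral>\<theta>. H \<theta> \<partial>post n \<omega>) - H \<theta>c) - gradH \<bullet> Zn n \<omega>) + V"
            by (simp add: R_def Y_def V_def algebra_simps)
          with K(2)[OF elim sets_post n] V \<open>V \<ge> 0\<close> show ?case
            unfolding Zn_def T_def distrib_right by linarith
        qed
      qed
    qed (use that in auto)
    then have "weak_conv_m (\<lambda>n. distr Q borel (\<lambda>\<omega>. gradH \<bullet> Zn n \<omega> + R n \<omega>)) (normal_law 0 S)"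
      by (intro Q.weak_conv_add_null real_normal wU) measurable
    then show ?thesis by (simp add: R_def Y_def)
  qed
  obtain \<gamma> where "\<gamma> > 0" "post_moment_tight Q post \<theta>c \<gamma>"
    using v unfolding Q_def post_def by blast
  \<comment> \<open>The first claim is the case \<open>w = 0\<close> with the given
    \<open>\<gamma>\<close>; the second is the case \<open>\<gamma> = 1\<close> with arbitrary
    \<open>w \<ge> 0\<close>.\<close>
  from main[OF this, of 0] main[of 1] show ?thesis
    unfolding Q_def post_def H_def S_def by simp
qed

end
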